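(* Consider the problem $\min_{x\in\mathbf{R}^N}[F(x):=f(x)+\Omega(x)]$, where: (i) $f:\mathbf{R}^N\to\mathbf{R}$ has the form $f(x)=\sum_{J\in\mathcal{J}}f_J(x)$, where $\mathcal{J}$ is a collection of subsets of $[n]$, each $f_J$ is convex and depends on $x$ only through the blocks $x^{(i)}$, $i\in J$, and $\|\nabla_i f(x+U_it)-\nabla_i f(x)\|_{(i)}^*\le L_i\|t\|_{(i)}$ for all $x\in\mathbf{R}^N$, $i\in[n]$, $t\in\mathbf{R}^{N_i}$, with constants $L_i>0$; (ii) $\Omega(x)=\sum_{i=1}^n\Omega_i(x^{(i)})$ with $\Omega_i:\mathbf{R}^{N_i}\to\mathbf{R}\cup\{+\infty\}$ convex and closed. Let $F^*$ be the (finite) optimal value, attained at a minimizer of $F$. Let $\hat Z$ be a $(C,\tau)$-distributed sampling associated with a balanced partition $P^{(1)},\dots,P^{(C)}$ of $[n]$ into sets of size $s=n/C$, $\tau\in\{1,\dots,s\}$. Let $\xi=\max\{|P^{(c)}\cap J|: c\in\{1,\dots,C\},\ J\in\mathcal{J}\}$ and $$\beta=1+\frac{(\xi-1)(\tau-1)}{\max\{1,s-1\}}+(C-1)\frac{\xi\tau}{s},\qquad w_i=L_i,\ i=1,\dots,n.$$ Assume moreover that $F$ is strongly convex with respect to $\|\cdot\|_w$ with $\mu_f(w)+\mu_\Omega(w)>0$, where $\mu_f(w)\ge0$ and $\mu_\Omega(w)\ge0$ are (strong) convexity parameters of $f$ and $\Omega$ with respect to $\|\cdot\|_w$. Choose an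 initial point $x_0\in\mathbf{R}^N$, a target confidence level $0<\rho<1$, a target accuracy level $0<\epsilon<F(x_0)-F^*$, and an iteration counter $K$ with $$K\ge\frac{n}{C\tau}\,\frac{\beta+\mu_\Omega(w)}{\mu_f(w)+\mu_\Omega(w)}\,\log\left(\frac{F(x_0)-F^*}{\epsilon\rho}\right).$$ If $\{x_k\}$ are the random points generated by the distributed block coordinate descent method with parameters $\beta,w$, started from $x_0$, where the random sets $Z_k$, $k\ge0$, are i.i.d. following the law of $\hat Z$, then $$\mathbf{Prob}(F(x_K)-F^*\le\epsilon)\ge1-\rho.$$
   Context: Block structure: $[n]=\{1,\dots,n\}$. The $N\times N$ identity matrix $U$ is decomposed by columns as $U=[U_1,\dots,U_n]$ with $U_i$ of size $N\times N_i$ and $\sum_{i=1}^n N_i=N$. For $x\in\mathbf{R}^N$, $x^{(i)}=U_i^Tx\in\mathbf{R}^{N_i}$ is block $i$ of $x$. The block gradient is $\nabla_i f(x)=U_i^T\nabla f(x)$. Norms: each $\mathbf{R}^{N_i}$ carries a norm $\|\cdot\|_{(i)}$ with conjugate norm $\|t\|_{(i)}^*=\max_{\|s\|_{(i)}\le1}\langle s,t\rangle$. For $w\in\mathbf{R}^n$ with positive entries, $\|x\|_w=\big(\sum_{i=1}^n w_i\|x^{(i)}\|_{(i)}^2\big)^{1/2}$. Strong convexity: $\phi:\mathbf{R}^N\to\mathbf{R}\cup\{+\infty\}$ is strongly convex with respect to $\|\cdot\|_w$ with convexity parameter $\mu_\phi(w)\ge0$ if $\phi(y)\ge\phi(x)+\langle\phi'(x),y-x\rangle+\frac{\mu_\phi(w)}{2}\|y-x\|_w^2$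 for all $x,y\in\mathrm{dom}\,\phi$, where $\phi'(x)$ is any subgradient of $\phi$ at $x$ (the case $\mu_\phi(w)=0$ is ordinary convexity). $(C,\tau)$-distributed sampling: $[n]$ is partitioned into $C$ pairwise disjoint sets $P^{(1)},\dots,P^{(C)}$, each of size $s=n/C$. For each $c$, $\hat Z^{(c)}$ is a random subset of $P^{(c)}$ of cardinality $\tau$, chosen uniformly among all subsets of $P^{(c)}$ of cardinality $\tau$, with the choices for different $c$ independent. Then $\hat Z=\bigcup_{c=1}^C\hat Z^{(c)}$. Distributed block coordinate descent method (with parameters $\beta>0$, $w\in\mathbf{R}^n_{>0}$): starting from $x_0$, for $k=0,1,2,\dots$ draw the random set $Z_k\subseteq[n]$ and set $$x_{k+1}=x_k+\sum_{i\in Z_k}U_i h^{(i)}(x_k),\qquad h^{(i)}(x_k)\in\arg\min_{t\in\mathbf{R}^{N_i}}\ \langle\nabla_i f(x_k),t\rangle+\frac{\beta w_i}{2}\|t\|_{(i)}^2+\Omega_i(x_k^{(i)}+t).$$ *)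

theory Defs
  imports "HOL-Probability.Probability" "HOL-Probability.Product_PMF"
begin

text \<open>
  The space \<open>R^N\<close> is \<^typ>\<open>real ^ 'm\<close>. The block structure is given by a map
  \<open>blk :: 'm \<Rightarrow> nat\<close> sending each coordinate to the index in \<open>{1..n}\<close> of its block, so that the
  columns of \<open>U_i\<close> are the unit vectors \<open>axis j 1\<close> with \<open>blk j = i\<close>. As there are no types
  \<open>R^(N_i)\<close> depending on \<open>i\<close>, the space \<open>R^(N_i)\<close> is identified, via \<open>U_i\<close>, with the coordinate
  subspace \<open>block_space blk i\<close>. Under this identification \<open>U_i\<close> is the inclusion, the block
  \<open>U_i^T x\<close> is \<open>block blk i x\<close>, and inner products are preserved. Block norms and
  functions on \<open>R^(N_i)\<close> are functions on \<^typ>\<open>real ^ 'm\<close> of which only the values on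
  \<open>block_space blk i\<close> are used.
\<close>

definition block_space :: "('m::finite \<Rightarrow> nat) \<Rightarrow> nat \<Rightarrow> (real ^ 'm) set" where
  "block_space blk i = {t. \<forall>j. blk j \<noteq> i \<longrightarrow> t $ j = 0}"

definition block :: "('m::finite \<Rightarrow> nat) \<Rightarrow> nat \<Rightarrow> real ^ 'm \<Rightarrow> real ^ 'm" where
  "block blk i x = (\<chi> j. if blk j = i then x $ j else 0)"

definition gradient :: "('a::real_inner \<Rightarrow> real) \<Rightarrow> 'a \<Rightarrow> 'a" where
  "gradient f x = (THE D. GDERIV f x :> D)"

definition is_norm_on :: "'a::real_vector set \<Rightarrow> ('a \<Rightarrow> real) \<Rightarrow> bool" where
  "is_norm_on S nrm \<longleftrightarrow>
     (\<forall>t\<in>S. 0 \<le> nrm t \<and> (nrm t = 0 \<longleftrightarrow> t = 0)) \<and>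
     (\<forall>t\<in>S. \<forall>a. nrm (a *\<^sub>R t) = \<bar>a\<bar> * nrm t) \<and>
     (\<forall>t\<in>S. \<forall>u\<in>S. nrm (t + u) \<le> nrm t + nrm u)"

text \<open>For a norm on a finite-dimensional subspace the supremum is attained, i.e. is a maximum.\<close>

definition conj_norm :: "'a::real_inner set \<Rightarrow> ('a \<Rightarrow> real) \<Rightarrow> 'a \<Rightarrow> real" where
  "conj_norm S nrm t = (SUP s\<in>{s\<in>S. nrm s \<le> 1}. s \<bullet> t)"

definition wnorm ::
  "('m::finite \<Rightarrow> nat) \<Rightarrow> nat \<Rightarrow> (nat \<Rightarrow> real ^ 'm \<Rightarrow> real) \<Rightarrow> (nat \<Rightarrow> real) \<Rightarrow> real ^ 'm \<Rightarrow> real" where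
  "wnorm blk n nrm w x = sqrt (\<Sum>i\<in>{1..n}. w i * (nrm i (block blk i x))\<^sup>2)"

definition ereal_epigraph :: "'a set \<Rightarrow> ('a \<Rightarrow> ereal) \<Rightarrow> ('a \<times> real) set" where
  "ereal_epigraph S \<phi> = {(x, r). x \<in> S \<and> \<phi> x \<le> ereal r}"

definition eff_dom :: "('a \<Rightarrow> ereal) \<Rightarrow> 'a set" where
  "eff_dom \<phi> = {x. \<phi> x < \<infinity>}"

definition subdifferential :: "('a::real_inner \<Rightarrow> ereal) \<Rightarrow> 'a \<Rightarrow> 'a set" where
  "subdifferential \<phi> x = {g. \<forall>y. \<phi> x + ereal (g \<bullet> (y - x)) \<le> \<phi> y}"

text \<open>The inequality is demanded for every subgradient at \<open>x\<close>; convexity of \<open>\<phi>\<close> itself is not part of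
  the definition.\<close>

definition strongly_convex_wrt ::
  "('a::real_inner \<Rightarrow> real) \<Rightarrow> ('a \<Rightarrow> ereal) \<Rightarrow> real \<Rightarrow> bool" where
  "strongly_convex_wrt nrm \<phi> \<mu> \<longleftrightarrow> 0 \<le> \<mu> \<and>
     (\<forall>x\<in>eff_dom \<phi>. \<forall>y\<in>eff_dom \<phi>. \<forall>g\<in>subdifferential \<phi> x.
        \<phi> x + ereal (g \<bullet> (y - x) + \<mu> / 2 * (nrm (y - x))\<^sup>2) \<le> \<phi> y)"

definition block_separable ::
  "('m::finite \<Rightarrow> nat) \<Rightarrow> nat \<Rightarrow> (nat \<Rightarrow> real ^ 'm \<Rightarrow> ereal) \<Rightarrow> real ^ 'm \<Rightarrow> ereal" where
  "block_separable blk n \<Omega> x = (\<Sum>i\<in>{1..n}. \<Omega> i (block blk i x))"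

definition balanced_partition :: "nat \<Rightarrow> nat \<Rightarrow> nat \<Rightarrow> (nat \<Rightarrow> nat set) \<Rightarrow> bool" where
  "balanced_partition n C s P \<longleftrightarrow>
     (\<Union>c\<in>{1..C}. P c) = {1..n} \<and> disjoint_family_on P {1..C} \<and> (\<forall>c\<in>{1..C}. card (P c) = s)"

text \<open>\<open>Pi_pmf\<close> is the product distribution, i.e. the choices for different \<open>c\<close> are independent.\<close>

definition distributed_sampling :: "nat \<Rightarrow> nat \<Rightarrow> (nat \<Rightarrow> nat set) \<Rightarrow> nat set pmf" where
  "distributed_sampling C \<tau> P =
     map_pmf (\<lambda>Z. \<Union>c\<in>{1..C}. Z c)
       (Pi_pmf {1..C} {} (\<lambda>c. pmf_of_set {S. S \<subseteq> P c \<and> card S = \<tau>}))"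

text \<open>The arg min need not be a singleton (the squared block norm need not be strictly convex), hence
  the following is a predicate: \<open>d\<close> is an admissible update of block \<open>i\<close> at the point \<open>y\<close>.\<close>

definition is_block_update ::
  "('m::finite \<Rightarrow> nat) \<Rightarrow> (nat \<Rightarrow> real ^ 'm \<Rightarrow> real) \<Rightarrow> (real ^ 'm \<Rightarrow> real) \<Rightarrow>
   (nat \<Rightarrow> real ^ 'm \<Rightarrow> ereal) \<Rightarrow> real \<Rightarrow> (nat \<Rightarrow> real) \<Rightarrow> nat \<Rightarrow> real ^ 'm \<Rightarrow> real ^ 'm \<Rightarrow> bool" where
  "is_block_update blk nrm f \<Omega> \<beta> w i y d \<longleftrightarrow>
     is_arg_min
       (\<lambda>t. ereal (block blk i (gradient f y) \<bullet> t + \<beta> * w i / 2 * (nrm i t)\<^sup>2) + \<Omega> i (block blk i y + t))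
       (\<lambda>t. t \<in> block_space blk i) d"

text \<open>\<open>Z k\<close> is the random set drawn and \<open>x k\<close> the random iterate, at step \<open>k\<close>, on the sample space \<open>W\<close>.\<close>

definition dbcd_iterates ::
  "'w set \<Rightarrow> ('m::finite \<Rightarrow> nat) \<Rightarrow> nat \<Rightarrow> (nat \<Rightarrow> real ^ 'm \<Rightarrow> real) \<Rightarrow> (real ^ 'm \<Rightarrow> real) \<Rightarrow>
   (nat \<Rightarrow> real ^ 'm \<Rightarrow> ereal) \<Rightarrow> real \<Rightarrow> (nat \<Rightarrow> real) \<Rightarrow> (nat \<Rightarrow> real ^ 'm \<Rightarrow> real ^ 'm) \<Rightarrow>
   (nat \<Rightarrow> 'w \<Rightarrow> nat set) \<Rightarrow> real ^ 'm \<Rightarrow> (nat \<Rightarrow> 'w \<Rightarrow> real ^ 'm) \<Rightarrow> bool" where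
  "dbcd_iterates W blk n nrm f \<Omega> \<beta> w h Z x0 x \<longleftrightarrow>
     (\<forall>\<omega>\<in>W. x 0 \<omega> = x0 \<and>
       (\<forall>k. (\<forall>i\<in>{1..n}. is_block_update blk nrm f \<Omega> \<beta> w i (x k \<omega>) (h i (x k \<omega>))) \<and>
            x (Suc k) \<omega> = x k \<omega> + (\<Sum>i\<in>Z k \<omega>. h i (x k \<omega>))))"

end

theory Submission
  imports Defs "HOL-Combinatorics.Transposition"
begin

text \<open>
  Overapproximation: enlarge every \<open>J \<in> \<J>\<close> to a set \<open>T\<close> meeting each part of the partition in
  exactly \<open>\<xi>\<close> blocks. By convexity, for a sample \<open>S\<close> with \<open>k = \<bar>S \<inter> T\<bar>\<close>, the increment of \<open>f\<^sub>J\<close> along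
  \<open>\<Sum>i\<in>S. d i\<close> is at most the average over \<open>i \<in> S \<inter> T\<close> of its increments along \<open>k d i\<close>. Bijections
  respecting the partition show that the joint law of \<open>i \<in> S\<close> and \<open>k\<close> is the same for all \<open>T\<close> and
  \<open>i \<in> T\<close>, so the sum over \<open>J\<close> can be taken inside and only the blockwise smoothness of the sum \<open>f\<close>
  is needed. The factor \<open>\<beta>\<close> is the expectation of \<open>k\<close> given \<open>i \<in> S\<close>.

  Contraction: the block updates minimize a separable model, which is compared with its value at the
  convex combination of the current point and a minimizer with weight
  \<open>(\<mu>\<^sub>f + \<mu>\<^sub>\<Omega>) / (\<beta> + \<mu>\<^sub>\<Omega>)\<close>. For this weight the quadratic terms cancel and the expected gap shrinks by
  a fixed factor per step. Markov's inequality concludes.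
\<close>

section \<open>Uniform sampling from a balanced partition\<close>

text \<open>Smoothness is given for \<open>f\<close> only, so quadratic bounds exist only after
  summing over \<open>J\<close>, whereas Jensen's inequality gives each \<open>fJ J\<close> its own
  random step length k. Equal laws of these lengths are what allows the sum to be formed first.
  Smoothness at step length k, divided by k, leaves one factor k on the quadratic term. Its mean
  given \<open>i \<in> S\<close> is 1, for i itself, plus the conditional inclusion probabilities of
  the other members of T: (\<tau> - 1)/(s - 1) in the part of i and \<tau>/s elsewhere. These add up
  to \<beta>. The weight of the convex combination must not exceed 1, which means \<mu>f \<le>
  \<beta>. This follows by playing the averaged upper bound against strong convexity in a single
  block. Strong convexity speaks of subgradients, which may be missing where the combination lies;
  approximate ones take their place. The update is an arbitrary selection of minimizers and need not
  be measurable. Iterates are therefore read as functions of finitely many samples with values in a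
  finite set. The rate is the weight times \<tau>/s = C\<tau>/n, the probability that a given block
  is drawn.\<close>

lemma bij_betw_extend:
  assumes "finite A" "finite B" "card A = card B" "A' \<subseteq> A" "B' \<subseteq> B" "bij_betw \<sigma>' A' B'"
  obtains \<sigma> where "bij_betw \<sigma> A B" "\<And>x. x \<in> A' \<Longrightarrow> \<sigma> x = \<sigma>' x"
proof -
  have "card A' = card B'"
    using assms(6) by (rule bij_betw_same_card)
  then have "card (A - A') = card (B - B')"
    using assms by (simp add: card_Diff_subset finite_subset)
  then obtain \<tau> where \<tau>: "bij_betw \<tau> (A - A') (B - B')"
    using finite_same_card_bij[of "A - A'" "B - B'"] assms by blast
  define \<sigma> where "\<sigma> x = (if x \<in> A' then \<sigma>' x else \<tau> x)" for x
  have "bij_betw \<sigma> A' B'"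
    using assms(6) by (subst bij_betw_cong[of _ _ \<sigma>']) (auto simp: \<sigma>_def)
  moreover have "bij_betw \<sigma> (A - A') (B - B')"
    using \<tau> by (subst bij_betw_cong[of _ _ \<tau>]) (auto simp: \<sigma>_def)
  ultimately have "bij_betw \<sigma> (A' \<union> (A - A')) (B' \<union> (B - B'))"
    by (rule bij_betw_combine) auto
  moreover have "A' \<union> (A - A') = A" "B' \<union> (B - B') = B"
    using assms by auto
  ultimately show ?thesis
    using that[of \<sigma>] by (simp add: \<sigma>_def)
qed

text \<open>Extending twice, from \<open>{a}\<close> to \<open>A'\<close> and then to
  \<open>A\<close>, respects both the subset and a marked point. Later the subset is the trace of an
  enlarged \<open>J\<close> on one part, and the point is a block in it.\<close>

lemma bij_betw_pointed_subset:
  assumes "finite A" "finite B" "card A = card B" "A' \<subseteq> A" "B' \<subseteq> B" "card A' = card B'"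
    "a \<in> A'" "b \<in> B'"
  obtains \<sigma> where "bij_betw \<sigma> A B" "\<sigma> ` A' = B'" "\<sigma> a = b"
proof -
  have fin: "finite A'" "finite B'"
    using assms finite_subset by auto
  have "bij_betw (\<lambda>_. b) {a} {b}"
    by auto
  then obtain \<sigma>' where \<sigma>': "bij_betw \<sigma>' A' B'" "\<And>x. x \<in> {a} \<Longrightarrow> \<sigma>' x = b"
    using bij_betw_extend[OF fin assms(6), of "{a}" "{b}"] assms by blast
  obtain \<sigma> where \<sigma>: "bij_betw \<sigma> A B" "\<And>x. x \<in> A' \<Longrightarrow> \<sigma> x = \<sigma>' x"
    using bij_betw_extend[OF assms(1-5) \<sigma>'(1)] by blast
  have "\<sigma> ` A' = \<sigma>' ` A'"
    using \<sigma>(2) by (rule image_cong[OF refl])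
  then have "\<sigma> ` A' = B'"
    using \<sigma>'(1) by (simp add: bij_betw_def)
  then show ?thesis
    using that[of \<sigma>] \<sigma> \<sigma>'(2) assms by auto
qed

lemma bij_betw_subset_image:
  assumes "finite A" "finite B" "card A = card B" "A' \<subseteq> A" "B' \<subseteq> B" "card A' = card B'"
  obtains \<sigma> where "bij_betw \<sigma> A B" "\<sigma> ` A' = B'"
proof (cases "A' = {}")
  case True
  then have "B' = {}"
    using assms by (metis card.empty card_eq_0_iff finite_subset)
  moreover obtain \<sigma> where "bij_betw \<sigma> A B"
    using finite_same_card_bij assms by blast
  ultimately show ?thesis
    using that[of \<sigma>] True by simp
next
  case False
  then obtain a where a: "a \<in> A'"
    by auto
  then have "B' \<noteq> {}"
    using assms by (metis card.empty card_eq_0_iff finite_subset False)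
  then obtain b where "b \<in> B'"
    by auto
  then show ?thesis
    using bij_betw_pointed_subset[OF assms a] that by blast
qed

text \<open>Jensen's inequality with equal weights at the points
  \<open>card A *\<^sub>R v i\<close>; \<open>\<psi> 0 = 0\<close> settles the empty sum.\<close>

lemma convex_sum_bound:
  fixes \<psi> :: "'a::real_vector \<Rightarrow> real"
  assumes "finite A" "convex_on UNIV \<psi>" "\<psi> 0 = 0"
  shows "\<psi> (\<Sum>i\<in>A. v i) \<le> (\<Sum>i\<in>A. \<psi> (real (card A) *\<^sub>R v i) / real (card A))"
proof (cases "A = {}")
  case True
  then show ?thesis using assms by simp
next
  case False
  let ?k = "real (card A)"
  have k: "0 < ?k"
    using assms False by (simp add: card_gt_0_iff)
  have "\<psi> (\<Sum>i\<in>A. (1 / ?k) *\<^sub>R (?k *\<^sub>R v i)) \<le> (\<Sum>i\<in>A. (1 / ?k) * \<psi> (?k *\<^sub>R v i))"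
    using assms False k by (intro convex_on_sum[of A UNIV]) auto
  then show ?thesis
    using k by simp
qed

section \<open>Uniform law and symmetries of the sampling\<close>

locale partition_sampling =
  fixes C s \<tau> :: nat and P :: "nat \<Rightarrow> 'b set"
  assumes fin_P: "\<And>c. c \<in> {1..C} \<Longrightarrow> finite (P c)"
    and card_P: "\<And>c. c \<in> {1..C} \<Longrightarrow> card (P c) = s"
    and disj_P: "disjoint_family_on P {1..C}"
    and tau_le: "1 \<le> \<tau>" "\<tau> \<le> s"
begin

definition V :: "'b set" where "V = (\<Union>c\<in>{1..C}. P c)"

text \<open>The support of the sampling. Its law is uniform, so expectations are written as finite
  sums over \<open>samples\<close>, with the factor \<open>card samples\<close> kept on the other
  side.\<close>

definition samples :: "'b set set" where
  "samples = {S. S \<subseteq> V \<and> (\<forall>c\<in>{1..C}. card (S \<inter> P c) = \<tau>)}"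

lemma finite_V: "finite V"
  unfolding V_def using fin_P by auto

lemma P_subset_V: "c \<in> {1..C} \<Longrightarrow> P c \<subseteq> V"
  unfolding V_def by auto

lemma P_disjoint: "c \<in> {1..C} \<Longrightarrow> d \<in> {1..C} \<Longrightarrow> c \<noteq> d \<Longrightarrow> P c \<inter> P d = {}"
  using disj_P unfolding disjoint_family_on_def by auto

lemma finite_samples: "finite samples"
  unfolding samples_def using finite_V by (auto intro: finite_subset[of _ "Pow V"])

lemma UN_Int_P:
  assumes "d \<in> {1..C}" "\<And>c. c \<in> {1..C} \<Longrightarrow> T c \<subseteq> P c"
  shows "(\<Union>c\<in>{1..C}. T c) \<inter> P d = T d"
proof -
  have "c = d" if "c \<in> {1..C}" "x \<in> T c" "x \<in> P d" for c x
    using that assms P_disjoint[of c d] by blast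
  then show ?thesis
    using assms by blast
qed

text \<open>Independent uniform choices are uniform on the product. Forming the union is injective
  there, since the choice in part \<open>c\<close> is recovered by intersecting with
  \<open>P c\<close>.\<close>

lemma samples_nonempty_and_uniform:
  "samples \<noteq> {} \<and>
   map_pmf (\<lambda>Z. \<Union>c\<in>{1..C}. Z c)
       (Pi_pmf {1..C} {} (\<lambda>c. pmf_of_set {S. S \<subseteq> P c \<and> card S = \<tau>})) = pmf_of_set samples"
proof -
  let ?B = "\<lambda>c. {S. S \<subseteq> P c \<and> card S = \<tau>}"
  let ?D = "PiE_dflt {1..C} {} ?B"
  let ?U = "\<lambda>Z. \<Union>c\<in>{1..C}. Z c :: 'b set"
  have fin: "finite (?B c)" if "c \<in> {1..C}" for c
    using fin_P[OF that] by simp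
  have ne: "?B c \<noteq> {}" if "c \<in> {1..C}" for c
    using obtain_subset_with_card_n[of \<tau> "P c"] tau_le card_P[OF that] by auto
  have Z_eq: "?U Z \<inter> P c = Z c" if "Z \<in> ?D" "c \<in> {1..C}" for Z c
    using that by (intro UN_Int_P) (auto simp: PiE_dflt_def)
  have inj: "inj_on ?U ?D"
  proof (rule inj_onI)
    fix Z Z' assume Z: "Z \<in> ?D" "Z' \<in> ?D" and eq: "?U Z = ?U Z'"
    show "Z = Z'"
    proof
      fix c
      show "Z c = Z' c"
      proof (cases "c \<in> {1..C}")
        case True
        then show ?thesis using Z_eq[of Z c] Z_eq[of Z' c] Z eq by simp
      next
        case False
        then show ?thesis using Z by (auto simp: PiE_dflt_def)
      qed
    qed
  qed
  have im: "?U ` ?D = samples"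
  proof (intro equalityI subsetI)
    fix S assume "S \<in> ?U ` ?D"
    then obtain Z where Z: "Z \<in> ?D" "S = ?U Z"
      by blast
    have "card (S \<inter> P c) = \<tau>" if "c \<in> {1..C}" for c
      using Z_eq[OF Z(1) that] Z that by (auto simp: PiE_dflt_def)
    moreover have "S \<subseteq> V"
      using Z by (auto simp: PiE_dflt_def V_def)
    ultimately show "S \<in> samples"
      by (simp add: samples_def)
  next
    fix S assume S: "S \<in> samples"
    define Z where "Z c = (if c \<in> {1..C} then S \<inter> P c else {})" for c
    have "Z \<in> ?D"
      using S by (auto simp: PiE_dflt_def Z_def samples_def)
    moreover have "S = ?U Z"
      using S by (auto simp: Z_def samples_def V_def)
    ultimately show "S \<in> ?U ` ?D"
      by blast
  qed
  have Dne: "?D \<noteq> {}"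
  proof -
    have "\<forall>c\<in>{1..C}. \<exists>S. S \<in> ?B c"
      using ne by blast
    from bchoice[OF this] obtain Z where "\<forall>c\<in>{1..C}. Z c \<in> ?B c" ..
    then have "(\<lambda>c. if c \<in> {1..C} then Z c else {}) \<in> ?D"
      by (auto simp: PiE_dflt_def)
    then show ?thesis
      by blast
  qed
  have Dfin: "finite ?D"
    using fin by (intro finite_PiE_dflt) auto
  have "map_pmf ?U (Pi_pmf {1..C} {} (\<lambda>c. pmf_of_set (?B c))) = map_pmf ?U (pmf_of_set ?D)"
    using fin ne by (subst Pi_pmf_of_set) auto
  also have "\<dots> = pmf_of_set (?U ` ?D)"
    using inj Dne Dfin by (rule map_pmf_of_set_inj)
  also have "?U ` ?D = samples"
    by (fact im)
  finally have "map_pmf ?U (Pi_pmf {1..C} {} (\<lambda>c. pmf_of_set (?B c))) = pmf_of_set samples" .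
  moreover have "samples \<noteq> {}"
    unfolding im[symmetric] using Dne by (simp only: image_is_empty not_False_eq_True)
  ultimately show ?thesis
    by blast
qed

lemma samples_nonempty: "samples \<noteq> {}"
  using samples_nonempty_and_uniform by blast

text \<open>As \<open>\<pi>\<close> permutes the parts, \<open>\<sigma>\<close> maps the finite set
  \<open>V\<close> onto itself and is injective by counting.\<close>

lemma inj_on_V:
  assumes "bij_betw \<pi> {1..C} {1..C}" "\<And>c. c \<in> {1..C} \<Longrightarrow> \<sigma> ` P c = P (\<pi> c)"
  shows "inj_on \<sigma> V"
proof -
  have "\<sigma> ` V = (\<Union>c\<in>{1..C}. P (\<pi> c))"
    using assms(2) by (simp add: V_def image_UN)
  also have "\<dots> = (\<Union>c\<in>\<pi> ` {1..C}. P c)"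
    by simp
  also have "\<dots> = V"
    using assms(1) by (simp add: bij_betw_def V_def)
  finally show ?thesis
    using finite_V by (intro eq_card_imp_inj_on) simp_all
qed

text \<open>A map permuting the parts acts on \<open>samples\<close> as an injection into itself,
  hence by finiteness as a permutation. Every symmetry of the sampling used below rests on this
  reindexing.\<close>

lemma sum_samples_image:
  assumes \<pi>: "bij_betw \<pi> {1..C} {1..C}" and \<sigma>: "\<And>c. c \<in> {1..C} \<Longrightarrow> \<sigma> ` P c = P (\<pi> c)"
  shows "(\<Sum>S\<in>samples. g (\<sigma> ` S)) = (\<Sum>S\<in>samples. g S)"
proof -
  have inj: "inj_on \<sigma> V"
    using assms by (rule inj_on_V)
  have "inj_on ((`) \<sigma>) (Pow V)"
    using inj by (rule inj_on_image_Pow)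
  then have inj': "inj_on ((`) \<sigma>) samples"
    by (rule inj_on_subset) (auto simp: samples_def)
  have "(`) \<sigma> ` samples \<subseteq> samples"
  proof (intro image_subsetI)
    fix S assume S: "S \<in> samples"
    have SV: "S \<subseteq> V"
      using S by (simp add: samples_def)
    have "card (\<sigma> ` S \<inter> P d) = \<tau>" if d: "d \<in> {1..C}" for d
    proof -
      obtain c where c: "c \<in> {1..C}" "\<pi> c = d"
        using \<pi> d by (metis bij_betw_def imageE)
      have "\<sigma> ` S \<inter> P d = \<sigma> ` (S \<inter> P c)"
        using inj_on_image_Int[OF inj SV P_subset_V[OF c(1)]] \<sigma>[OF c(1)] c by simp
      moreover have "inj_on \<sigma> (S \<inter> P c)"
        using inj SV by (auto intro: inj_on_subset)
      ultimately show ?thesis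
        using S c by (simp add: card_image samples_def)
    qed
    moreover have "\<sigma> ` S \<subseteq> V"
    proof -
      have "\<sigma> ` P c \<subseteq> V" if "c \<in> {1..C}" for c
        using \<sigma>[OF that] P_subset_V[of "\<pi> c"] bij_betwE[OF \<pi>] that by auto
      then have "\<sigma> ` V \<subseteq> V"
        unfolding V_def image_UN by (rule UN_least)
      then show ?thesis
        using SV by auto
    qed
    ultimately show "\<sigma> ` S \<in> samples"
      by (simp add: samples_def)
  qed
  then have "(`) \<sigma> ` samples = samples"
    using finite_samples inj' by (intro endo_inj_surj) auto
  then show ?thesis
    using sum.reindex[OF inj', of g] by (simp add: o_def)
qed

definition balanced_set :: "nat \<Rightarrow> 'b set \<Rightarrow> bool" where
  "balanced_set \<xi> T \<longleftrightarrow> T \<subseteq> V \<and> (\<forall>c\<in>{1..C}. card (T \<inter> P c) = \<xi>)"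

text \<open>Inside every part \<open>P c \<inter> J\<close> is padded to \<open>\<xi>\<close>
  elements; \<open>\<xi> \<le> s\<close> leaves room for this.\<close>

lemma balanced_set_extend:
  assumes "J \<subseteq> V" "\<And>c. c \<in> {1..C} \<Longrightarrow> card (P c \<inter> J) \<le> \<xi>" "\<xi> \<le> s"
  obtains T where "J \<subseteq> T" "balanced_set \<xi> T"
proof -
  have "\<exists>B. P c \<inter> J \<subseteq> B \<and> B \<subseteq> P c \<and> card B = \<xi>" if "c \<in> {1..C}" for c
    using assms that fin_P card_P by (intro exists_subset_between) auto
  then obtain B where B: "\<And>c. c \<in> {1..C} \<Longrightarrow> P c \<inter> J \<subseteq> B c \<and> B c \<subseteq> P c \<and> card (B c) = \<xi>"
    by metis
  have "(\<Union>c\<in>{1..C}. B c) \<inter> P c = B c" if "c \<in> {1..C}" for c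
    using that B by (intro UN_Int_P) auto
  moreover have "(\<Union>c\<in>{1..C}. B c) \<subseteq> V"
    unfolding V_def using B by (intro UN_mono) auto
  moreover have "J \<subseteq> (\<Union>c\<in>{1..C}. B c)"
  proof
    fix x assume x: "x \<in> J"
    then obtain c where "c \<in> {1..C}" "x \<in> P c"
      using assms(1) by (auto simp: V_def)
    then show "x \<in> (\<Union>c\<in>{1..C}. B c)"
      using B[of c] x by auto
  qed
  ultimately show ?thesis
    using that[of "\<Union>c\<in>{1..C}. B c"] B by (auto simp: balanced_set_def)
qed

text \<open>Some permutation of \<open>V\<close> carries parts to parts, \<open>T\<close> to
  \<open>T'\<close> and \<open>i\<close> to \<open>i'\<close>. Quantifying over \<open>g\<close>
  expresses that the joint laws of membership and intersection size agree.\<close>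

lemma samples_symmetric:
  assumes T: "balanced_set \<xi> T" "balanced_set \<xi> T'" and i: "i \<in> T" "i' \<in> T'"
  shows "(\<Sum>S\<in>samples. g (i \<in> S) (card (S \<inter> T))) = (\<Sum>S\<in>samples. g (i' \<in> S) (card (S \<inter> T')))"
proof -
  obtain a where a: "a \<in> {1..C}" "i \<in> P a"
    using T i by (auto simp: balanced_set_def V_def)
  obtain b where b: "b \<in> {1..C}" "i' \<in> P b"
    using T i by (auto simp: balanced_set_def V_def)
  \<comment> \<open>The parts of \<open>i\<close> and \<open>i'\<close> may differ and are
    exchanged; for \<open>a = b\<close> this is the identity.\<close>
  define \<pi> where "\<pi> = Transposition.transpose a b"
  have \<pi>: "bij_betw \<pi> {1..C} {1..C}"
    using a b by (simp add: \<pi>_def bij_betw_def)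
  have \<pi>C: "\<pi> c \<in> {1..C}" if "c \<in> {1..C}" for c
    using \<pi> that by (rule bij_betw_apply)
  have \<pi>a: "\<pi> a = b"
    by (simp add: \<pi>_def)
  have "\<exists>\<sigma>. bij_betw \<sigma> (P c) (P (\<pi> c)) \<and> \<sigma> ` (T \<inter> P c) = T' \<inter> P (\<pi> c) \<and> (c = a \<longrightarrow> \<sigma> i = i')"
    if c: "c \<in> {1..C}" for c
  proof -
    have prems: "finite (P c)" "finite (P (\<pi> c))" "card (P c) = card (P (\<pi> c))"
      "T \<inter> P c \<subseteq> P c" "T' \<inter> P (\<pi> c) \<subseteq> P (\<pi> c)" "card (T \<inter> P c) = card (T' \<inter> P (\<pi> c))"
      using c \<pi>C[OF c] fin_P card_P T by (simp_all add: balanced_set_def)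
    show ?thesis
    proof (cases "c = a")
      case True
      have "i \<in> T \<inter> P c" "i' \<in> T' \<inter> P (\<pi> c)"
        using i a b True \<pi>a by auto
      from bij_betw_pointed_subset[OF prems this] show ?thesis
        by metis
    next
      case False
      then show ?thesis
        using bij_betw_subset_image[OF prems] by metis
    qed
  qed
  then obtain \<sigma>s where \<sigma>s: "\<And>c. c \<in> {1..C} \<Longrightarrow> bij_betw (\<sigma>s c) (P c) (P (\<pi> c)) \<and>
      \<sigma>s c ` (T \<inter> P c) = T' \<inter> P (\<pi> c) \<and> (c = a \<longrightarrow> \<sigma>s c i = i')"
    by metis
  \<comment> \<open>The bijections of the single parts are glued; disjointness makes the part of
    \<open>x\<close> unique.\<close>
  define \<sigma> where "\<sigma> x = \<sigma>s (THE c. c \<in> {1..C} \<and> x \<in> P c) x" for x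
  have \<sigma>: "\<sigma> x = \<sigma>s c x" if "c \<in> {1..C}" "x \<in> P c" for c x
  proof -
    have "(THE d. d \<in> {1..C} \<and> x \<in> P d) = c"
      using that P_disjoint by (intro the_equality) auto
    then show ?thesis
      by (simp add: \<sigma>_def)
  qed
  have \<sigma>P: "\<sigma> ` P c = P (\<pi> c)" if c: "c \<in> {1..C}" for c
  proof -
    have "\<sigma> ` P c = \<sigma>s c ` P c"
      using \<sigma>[OF c] by (rule image_cong[OF refl])
    then show ?thesis
      using \<sigma>s[OF c] by (simp add: bij_betw_def)
  qed
  have \<sigma>T: "\<sigma> ` (T \<inter> P c) = T' \<inter> P (\<pi> c)" if c: "c \<in> {1..C}" for c
  proof -
    have "\<sigma> ` (T \<inter> P c) = \<sigma>s c ` (T \<inter> P c)"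
      using \<sigma>[OF c] by (intro image_cong[OF refl]) auto
    then show ?thesis
      using \<sigma>s[OF c] by simp
  qed
  have inj: "inj_on \<sigma> V"
    using \<pi> \<sigma>P by (rule inj_on_V)
  have TV: "T \<subseteq> V" "T' \<subseteq> V"
    using T by (simp_all add: balanced_set_def)
  have "\<sigma> ` T = \<sigma> ` (\<Union>c\<in>{1..C}. T \<inter> P c)"
    using TV(1) unfolding V_def by (intro arg_cong[of _ _ "(`) \<sigma>"]) blast
  also have "\<dots> = (\<Union>c\<in>{1..C}. \<sigma> ` (T \<inter> P c))"
    by (rule image_UN)
  also have "\<dots> = (\<Union>c\<in>{1..C}. T' \<inter> P (\<pi> c))"
    using \<sigma>T by (rule SUP_cong[OF refl])
  also have "\<dots> = (\<Union>c\<in>\<pi> ` {1..C}. T' \<inter> P c)"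
    by simp
  also have "\<dots> = T'"
    using TV(2) \<pi> unfolding V_def bij_betw_def by auto
  finally have \<sigma>TT: "\<sigma> ` T = T'" .
  have \<sigma>i: "\<sigma> i = i'"
    using \<sigma>[OF a] \<sigma>s[OF a(1)] by simp
  have "(\<Sum>S\<in>samples. g (i' \<in> S) (card (S \<inter> T'))) =
      (\<Sum>S\<in>samples. g (i' \<in> \<sigma> ` S) (card (\<sigma> ` S \<inter> T')))"
    using sum_samples_image[OF \<pi> \<sigma>P, of "\<lambda>S. g (i' \<in> S) (card (S \<inter> T'))"] by simp
  also have "\<dots> = (\<Sum>S\<in>samples. g (i \<in> S) (card (S \<inter> T)))"
  proof (rule sum.cong[OF refl])
    fix S assume "S \<in> samples"
    then have SV: "S \<subseteq> V"
      by (simp add: samples_def)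
    have "i' \<in> \<sigma> ` S \<longleftrightarrow> i \<in> S"
      using inj_on_image_mem_iff[OF inj, of i S] SV TV i \<sigma>i by auto
    moreover have "\<sigma> ` S \<inter> T' = \<sigma> ` (S \<inter> T)"
      using inj_on_image_Int[OF inj SV TV(1)] \<sigma>TT by simp
    moreover have "inj_on \<sigma> (S \<inter> T)"
      using inj SV by (auto intro: inj_on_subset)
    ultimately show "g (i' \<in> \<sigma> ` S) (card (\<sigma> ` S \<inter> T')) = g (i \<in> S) (card (S \<inter> T))"
      by (simp add: card_image)
  qed
  finally show ?thesis
    by simp
qed

section \<open>Inclusion frequencies of single elements and of pairs\<close>

lemma sum_samples_card_Int:
  assumes "finite A"
  shows "(\<Sum>j\<in>A. \<Sum>S\<in>samples. g S * of_bool (j \<in> S)) = (\<Sum>S\<in>samples. g S * real (card (S \<inter> A)))"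
proof -
  have "(\<Sum>j\<in>A. \<Sum>S\<in>samples. g S * of_bool (j \<in> S)) = (\<Sum>S\<in>samples. g S * (\<Sum>j\<in>A. of_bool (j \<in> S)))"
    by (subst sum.swap) (simp add: sum_distrib_left)
  also have "\<dots> = (\<Sum>S\<in>samples. g S * real (card (S \<inter> A)))"
    using assms by (simp add: of_bool_def sum.If_cases Int_commute)
  finally show ?thesis .
qed

text \<open>The whole of \<open>V\<close> is balanced with parameter \<open>s\<close>, so symmetry
  makes all members of a part equally frequent, and every sample contains \<open>\<tau>\<close> of
  these \<open>s\<close> members.\<close>

lemma sum_samples_marginal:
  assumes i: "i \<in> V"
  shows "(\<Sum>S\<in>samples. of_bool (i \<in> S)) = real (card samples) * (real \<tau> / real s)"
proof -
  obtain c where c: "c \<in> {1..C}" "i \<in> P c"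
    using i by (auto simp: V_def)
  have bal: "balanced_set s V"
    using card_P P_subset_V by (simp add: balanced_set_def Int_absorb1)
  have "(\<Sum>S\<in>samples. of_bool (j \<in> S)) = (\<Sum>S\<in>samples. of_bool (i \<in> S) :: real)" if "j \<in> P c" for j
    using samples_symmetric[OF bal bal, of j i "\<lambda>b _. of_bool b :: real"] i that P_subset_V[OF c(1)] by auto
  then have "real s * (\<Sum>S\<in>samples. of_bool (i \<in> S)) = (\<Sum>j\<in>P c. \<Sum>S\<in>samples. of_bool (j \<in> S))"
    using card_P[OF c(1)] by simp
  also have "\<dots> = (\<Sum>S\<in>samples. real (card (S \<inter> P c)))"
    using sum_samples_card_Int[OF fin_P[OF c(1)], of "\<lambda>_. 1"] by simp
  also have "\<dots> = real (card samples) * real \<tau>"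
    using c by (simp add: samples_def)
  finally show ?thesis
    using tau_le by (simp add: field_simps)
qed

text \<open>A sample containing \<open>i\<close> has \<open>\<tau>\<close> elements in
  \<open>P d - {i}\<close>, or \<open>\<tau> - 1\<close> if \<open>i\<close> lies in
  \<open>P d\<close>. The members of that set share them equally, because transposing two of them
  fixes \<open>i\<close>. The product form covers both cases.\<close>

lemma sum_samples_pair:
  assumes d: "d \<in> {1..C}" and j: "j \<in> P d" "j \<noteq> i" and i: "i \<in> V"
  shows "real (card (P d - {i})) * (\<Sum>S\<in>samples. of_bool (i \<in> S) * of_bool (j \<in> S))
     = (real \<tau> - of_bool (i \<in> P d)) * (\<Sum>S\<in>samples. of_bool (i \<in> S))"
proof -
  have eq: "(\<Sum>S\<in>samples. of_bool (i \<in> S) * of_bool (j' \<in> S)) =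
      (\<Sum>S\<in>samples. of_bool (i \<in> S) * of_bool (j \<in> S) :: real)" if j': "j' \<in> P d - {i}" for j'
  proof -
    let ?\<sigma> = "Transposition.transpose j j'"
    have \<sigma>: "?\<sigma> ` P c = P (id c)" if "c \<in> {1..C}" for c
    proof -
      have "j \<in> P c \<longleftrightarrow> j' \<in> P c"
        using P_disjoint[OF that d] j j' that d by (cases "c = d") auto
      then show ?thesis
        by simp
    qed
    have "i \<in> ?\<sigma> ` S \<longleftrightarrow> i \<in> S" "j' \<in> ?\<sigma> ` S \<longleftrightarrow> j \<in> S" for S
      using j j' by (auto simp: in_transpose_image_iff)
    then show ?thesis
      using sum_samples_image[of id ?\<sigma> "\<lambda>S. of_bool (i \<in> S) * of_bool (j' \<in> S) :: real"] \<sigma> by simp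
  qed
  have "real (card (P d - {i})) * (\<Sum>S\<in>samples. of_bool (i \<in> S) * of_bool (j \<in> S))
      = (\<Sum>j'\<in>P d - {i}. \<Sum>S\<in>samples. of_bool (i \<in> S) * of_bool (j' \<in> S))"
    using eq by simp
  also have "\<dots> = (\<Sum>S\<in>samples. of_bool (i \<in> S) * real (card (S \<inter> (P d - {i}))))"
    using fin_P[OF d] by (intro sum_samples_card_Int) simp
  also have "\<dots> = (\<Sum>S\<in>samples. (real \<tau> - of_bool (i \<in> P d)) * of_bool (i \<in> S))"
  proof (rule sum.cong[OF refl])
    fix S assume S: "S \<in> samples"
    have "card (S \<inter> P d) = \<tau>"
      using S d by (simp add: samples_def)
    moreover have "S \<inter> (P d - {i}) = (S \<inter> P d) - {i}"
      by auto
    ultimately show "of_bool (i \<in> S) * real (card (S \<inter> (P d - {i}))) =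
        (real \<tau> - of_bool (i \<in> P d)) * of_bool (i \<in> S)"
      using tau_le by (simp add: card_Diff_singleton_if of_nat_diff)
  qed
  finally show ?thesis
    by (simp add: sum_distrib_left)
qed

text \<open>The origin of \<open>\<beta>\<close>. Relative to the frequency of \<open>i\<close>, the
  element \<open>i\<close> counts 1, each of the \<open>\<xi> - 1\<close> others of \<open>T\<close>
  in its part counts \<open>(\<tau> - 1) / (s - 1)\<close>, and each of the \<open>\<xi>\<close>
  elements in every other part counts \<open>\<tau> / s\<close>.\<close>

lemma sum_samples_balanced:
  assumes T: "balanced_set \<xi> T" and i: "i \<in> T"
  shows "(\<Sum>S\<in>samples. of_bool (i \<in> S) * real (card (S \<inter> T))) =
    real (card samples) * (real \<tau> / real s) *
    (1 + (real \<xi> - 1) * (real \<tau> - 1) / max 1 (real s - 1) + (real C - 1) * (real \<xi> * real \<tau> / real s))"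
proof -
  define N where "N = (\<Sum>S\<in>samples. of_bool (i \<in> S) :: real)"
  define N2 where "N2 j = (\<Sum>S\<in>samples. of_bool (i \<in> S) * of_bool (j \<in> S) :: real)" for j
  have iV: "i \<in> V" and TV: "T \<subseteq> V"
    using T i by (auto simp: balanced_set_def)
  obtain c where c: "c \<in> {1..C}" "i \<in> P c"
    using iV by (auto simp: V_def)
  have finT: "finite T"
    using TV finite_V finite_subset by auto
  have other: "(\<Sum>j\<in>T \<inter> P d. N2 j) = real \<xi> * real \<tau> / real s * N" if d: "d \<in> {1..C} - {c}" for d
  proof -
    have iPd: "i \<notin> P d"
      using d c P_disjoint[of c d] by auto
    have "N2 j = real \<tau> / real s * N" if "j \<in> T \<inter> P d" for j
    proof -
      have "j \<noteq> i"
        using that iPd by auto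
      then show ?thesis
        using sum_samples_pair[of d j i] that d iPd iV card_P[of d] tau_le
        by (simp add: N2_def N_def field_simps)
    qed
    then show ?thesis
      using T d by (simp add: balanced_set_def)
  qed
  have same: "(\<Sum>j\<in>T \<inter> P c. N2 j) = (1 + (real \<xi> - 1) * (real \<tau> - 1) / max 1 (real s - 1)) * N"
  proof -
    have fin: "finite (T \<inter> P c)"
      using finT by auto
    have xi: "card (T \<inter> P c) = \<xi>"
      using T c by (simp add: balanced_set_def)
    have cardTc: "real (card (T \<inter> P c - {i})) = real \<xi> - 1"
    proof -
      have "0 < \<xi>"
        using xi i c fin card_gt_0_iff[of "T \<inter> P c"] by auto
      then show ?thesis
        using xi i c by (simp add: card_Diff_singleton of_nat_diff)
    qed
    \<comment> \<open>The existence of \<open>j\<close> forces \<open>s \<ge> 2\<close>, so the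
      maximum is \<open>s - 1\<close>. For \<open>s = 1\<close> there is no such \<open>j\<close>,
      and the factor \<open>\<xi> - 1\<close> vanishes.\<close>
    have "N2 j = (real \<tau> - 1) / max 1 (real s - 1) * N" if j: "j \<in> T \<inter> P c - {i}" for j
    proof -
      have "{i, j} \<subseteq> P c"
        using j c by auto
      then have "card {i, j} \<le> s"
        using card_mono[OF fin_P[OF c(1)]] card_P[OF c(1)] by metis
      then have "2 \<le> s"
        using j by auto
      moreover have "card (P c - {i}) = s - 1"
        using c card_P by (simp add: card_Diff_singleton)
      ultimately show ?thesis
        using sum_samples_pair[of c j i] j c iV by (simp add: N2_def N_def field_simps of_nat_diff)
    qed
    then have "(\<Sum>j\<in>T \<inter> P c - {i}. N2 j) = (real \<xi> - 1) * ((real \<tau> - 1) / max 1 (real s - 1) * N)"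
      using cardTc by simp
    moreover have "N2 i = N"
      unfolding N2_def N_def by (intro sum.cong) auto
    moreover have "(\<Sum>j\<in>T \<inter> P c. N2 j) = N2 i + (\<Sum>j\<in>T \<inter> P c - {i}. N2 j)"
      using fin i c by (intro sum.remove) auto
    ultimately show ?thesis
      by (simp add: algebra_simps)
  qed
  have "(\<Sum>S\<in>samples. of_bool (i \<in> S) * real (card (S \<inter> T))) = (\<Sum>j\<in>T. N2 j)"
    unfolding N2_def using sum_samples_card_Int[OF finT, of "\<lambda>S. of_bool (i \<in> S)"] by simp
  also have "\<dots> = (\<Sum>j\<in>(\<Union>d\<in>{1..C}. T \<inter> P d). N2 j)"
    using TV by (intro sum.cong) (auto simp: V_def)
  also have "\<dots> = (\<Sum>d\<in>{1..C}. \<Sum>j\<in>T \<inter> P d. N2 j)"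
    by (intro sum.UNION_disjoint) (simp, use finT in simp, use P_disjoint in blast)
  also have "\<dots> = (\<Sum>j\<in>T \<inter> P c. N2 j) + (\<Sum>d\<in>{1..C} - {c}. \<Sum>j\<in>T \<inter> P d. N2 j)"
    using c by (intro sum.remove) auto
  also have "(\<Sum>d\<in>{1..C} - {c}. \<Sum>j\<in>T \<inter> P d. N2 j) = (\<Sum>d\<in>{1..C} - {c}. real \<xi> * real \<tau> / real s * N)"
    using other by (rule sum.cong[OF refl])
  also have "\<dots> = (real C - 1) * (real \<xi> * real \<tau> / real s) * N"
    using c by (simp add: card_Diff_singleton of_nat_diff)
  finally have "(\<Sum>S\<in>samples. of_bool (i \<in> S) * real (card (S \<inter> T))) =
      N * (1 + (real \<xi> - 1) * (real \<tau> - 1) / max 1 (real s - 1) + (real C - 1) * (real \<xi> * real \<tau> / real s))"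
    unfolding same by (simp add: distrib_left distrib_right mult_ac)
  then show ?thesis
    using sum_samples_marginal[OF iV] by (simp only: N_def)
qed

text \<open>Abstract form for arbitrary directions \<open>v i\<close>, where \<open>a i\<close> and
  \<open>b i\<close> are the linear and quadratic coefficients of the summed increments. The linear
  one is multiplied by the frequency of \<open>i\<close>, the quadratic one by the frequency
  weighted with the intersection size, hence the factor \<open>\<beta>\<close>.\<close>

lemma expected_separable_overapproximation:
  fixes \<psi> :: "'j \<Rightarrow> 'a::real_vector \<Rightarrow> real" and v :: "'b \<Rightarrow> 'a" and \<xi> :: nat
  defines "\<beta> \<equiv> 1 + (real \<xi> - 1) * (real \<tau> - 1) / max 1 (real s - 1) + (real C - 1) * (real \<xi> * real \<tau> / real s)"
  assumes ne: "\<J> \<noteq> {}" and \<xi>: "0 < \<xi>"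
    and T: "\<And>J. J \<in> \<J> \<Longrightarrow> balanced_set \<xi> (T J)"
    and conv: "\<And>J. J \<in> \<J> \<Longrightarrow> convex_on UNIV (\<psi> J)"
    and zero: "\<And>J. J \<in> \<J> \<Longrightarrow> \<psi> J 0 = 0"
    and vanish: "\<And>J i r. J \<in> \<J> \<Longrightarrow> i \<in> V \<Longrightarrow> i \<notin> T J \<Longrightarrow> \<psi> J (r *\<^sub>R v i) = 0"
    and restr: "\<And>J S. J \<in> \<J> \<Longrightarrow> S \<subseteq> V \<Longrightarrow> \<psi> J (\<Sum>i\<in>S. v i) = \<psi> J (\<Sum>i\<in>S \<inter> T J. v i)"
    and bound: "\<And>i r. i \<in> V \<Longrightarrow> (\<Sum>J\<in>\<J>. \<psi> J (r *\<^sub>R v i)) \<le> r * a i + r\<^sup>2 * b i"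
  shows "(\<Sum>S\<in>samples. \<Sum>J\<in>\<J>. \<psi> J (\<Sum>i\<in>S. v i))
    \<le> real (card samples) * (real \<tau> / real s) * (\<Sum>i\<in>V. a i + \<beta> * b i)"
proof -
  define q where "q J i k = \<psi> J (real k *\<^sub>R v i) / real k" for J i k
  have pointwise: "\<psi> J (\<Sum>i\<in>S. v i) \<le> (\<Sum>i\<in>V. of_bool (i \<in> T J) * (of_bool (i \<in> S) * q J i (card (S \<inter> T J))))"
    if J: "J \<in> \<J>" and S: "S \<in> samples" for J S
  proof -
    have SV: "S \<subseteq> V"
      using S by (simp add: samples_def)
    then have fin: "finite (S \<inter> T J)"
      using finite_V finite_subset by blast
    have "\<psi> J (\<Sum>i\<in>S. v i) \<le> (\<Sum>i\<in>S \<inter> T J. q J i (card (S \<inter> T J)))"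
      unfolding restr[OF J SV] q_def using convex_sum_bound[OF fin conv[OF J] zero[OF J]] .
    also have "\<dots> = (\<Sum>i\<in>V. of_bool (i \<in> T J) * (of_bool (i \<in> S) * q J i (card (S \<inter> T J))))"
      using SV finite_V by (intro sum.mono_neutral_cong_left) auto
    finally show ?thesis .
  qed
  have block: "(\<Sum>J\<in>\<J>. \<Sum>S\<in>samples. of_bool (i \<in> T J) * (of_bool (i \<in> S) * q J i (card (S \<inter> T J))))
      \<le> real (card samples) * (real \<tau> / real s) * (a i + \<beta> * b i)" if i: "i \<in> V" for i
  proof -
    \<comment> \<open>A reference pair \<open>i0 \<in> T J0\<close>, the same for all
      \<open>J\<close>; \<open>\<xi> > 0\<close> provides \<open>i0\<close>.\<close>
    obtain J0 where J0: "J0 \<in> \<J>"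
      using ne by auto
    obtain c where "c \<in> {1..C}"
      using i by (auto simp: V_def)
    then have "T J0 \<inter> P c \<noteq> {}"
      using T[OF J0] \<xi> unfolding balanced_set_def by (metis card.empty less_irrefl)
    then obtain i0 where i0: "i0 \<in> T J0"
      by auto
    let ?k = "\<lambda>S. card (S \<inter> T J0)"
    have "(\<Sum>S\<in>samples. of_bool (i \<in> T J) * (of_bool (i \<in> S) * q J i (card (S \<inter> T J))))
        = (\<Sum>S\<in>samples. of_bool (i0 \<in> S) * q J i (?k S))" if J: "J \<in> \<J>" for J
    proof (cases "i \<in> T J")
      case True
      then show ?thesis
        using samples_symmetric[OF T[OF J] T[OF J0] True i0, of "\<lambda>t k. of_bool t * q J i k"] by simp
    next
      \<comment> \<open>The replacement must hold for all \<open>J\<close>, also those with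
        \<open>i \<notin> T J\<close>. There the left side vanishes by its indicator and the right
        side because \<open>\<psi> J\<close> is zero along \<open>v i\<close>.\<close>
      case False
      then show ?thesis
        using vanish[OF J i] by (simp add: q_def)
    qed
    then have "(\<Sum>J\<in>\<J>. \<Sum>S\<in>samples. of_bool (i \<in> T J) * (of_bool (i \<in> S) * q J i (card (S \<inter> T J))))
        = (\<Sum>J\<in>\<J>. \<Sum>S\<in>samples. of_bool (i0 \<in> S) * q J i (?k S))"
      by (rule sum.cong[OF refl])
    also have "\<dots> = (\<Sum>S\<in>samples. of_bool (i0 \<in> S) * ((\<Sum>J\<in>\<J>. \<psi> J (real (?k S) *\<^sub>R v i)) / real (?k S)))"
      by (subst sum.swap) (simp add: q_def sum_distrib_left sum_divide_distrib)
    also have "\<dots> \<le> (\<Sum>S\<in>samples. of_bool (i0 \<in> S) * (a i + real (?k S) * b i))"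
    proof (rule sum_mono)
      fix S assume "S \<in> samples"
      then have "finite (S \<inter> T J0)"
        using finite_V finite_subset by (fastforce simp: samples_def)
      show "of_bool (i0 \<in> S) * ((\<Sum>J\<in>\<J>. \<psi> J (real (?k S) *\<^sub>R v i)) / real (?k S))
          \<le> of_bool (i0 \<in> S) * (a i + real (?k S) * b i)"
      proof (cases "i0 \<in> S")
        case True
        then have k: "0 < real (?k S)"
          using i0 \<open>finite (S \<inter> T J0)\<close> by (auto simp: card_gt_0_iff)
        \<comment> \<open>Smoothness of the sum at step length \<open>k\<close>: dividing
          \<open>k * a i + k\<^sup>2 * b i\<close> by \<open>k > 0\<close> leaves a single factor
          \<open>k\<close> on \<open>b i\<close>.\<close>
        have "(\<Sum>J\<in>\<J>. \<psi> J (real (?k S) *\<^sub>R v i)) \<le> (a i + real (?k S) * b i) * real (?k S)"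
          using bound[OF i, of "real (?k S)"] by (simp add: algebra_simps power2_eq_square)
        then show ?thesis
          using True k by (simp add: pos_divide_le_eq)
      qed simp
    qed
    also have "\<dots> = (\<Sum>S\<in>samples. of_bool (i0 \<in> S)) * a i + (\<Sum>S\<in>samples. of_bool (i0 \<in> S) * real (?k S)) * b i"
      by (simp add: distrib_left sum.distrib sum_distrib_right mult.assoc)
    also have "\<dots> = real (card samples) * (real \<tau> / real s) * (a i + \<beta> * b i)"
    proof -
      have "i0 \<in> V"
        using T[OF J0] i0 by (auto simp: balanced_set_def)
      then show ?thesis
        unfolding sum_samples_balanced[OF T[OF J0] i0, folded \<beta>_def] sum_samples_marginal[OF \<open>i0 \<in> V\<close>]
        by (simp only: distrib_left mult.assoc)
    qed
    finally show ?thesis .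
  qed
  have "(\<Sum>S\<in>samples. \<Sum>J\<in>\<J>. \<psi> J (\<Sum>i\<in>S. v i)) \<le>
      (\<Sum>S\<in>samples. \<Sum>J\<in>\<J>. \<Sum>i\<in>V. of_bool (i \<in> T J) * (of_bool (i \<in> S) * q J i (card (S \<inter> T J))))"
    using pointwise by (intro sum_mono)
  also have "\<dots> = (\<Sum>S\<in>samples. \<Sum>i\<in>V. \<Sum>J\<in>\<J>. of_bool (i \<in> T J) * (of_bool (i \<in> S) * q J i (card (S \<inter> T J))))"
    by (intro sum.cong refl sum.swap)
  also have "\<dots> = (\<Sum>i\<in>V. \<Sum>S\<in>samples. \<Sum>J\<in>\<J>. of_bool (i \<in> T J) * (of_bool (i \<in> S) * q J i (card (S \<inter> T J))))"
    by (rule sum.swap)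
  also have "\<dots> = (\<Sum>i\<in>V. \<Sum>J\<in>\<J>. \<Sum>S\<in>samples. of_bool (i \<in> T J) * (of_bool (i \<in> S) * q J i (card (S \<inter> T J))))"
    by (intro sum.cong refl sum.swap)
  also have "\<dots> \<le> (\<Sum>i\<in>V. real (card samples) * (real \<tau> / real s) * (a i + \<beta> * b i))"
    using block by (rule sum_mono)
  finally show ?thesis
    by (simp add: sum_distrib_left)
qed

end

section \<open>Smoothness and approximate subgradients\<close>

text \<open>\<open>gradient\<close> is a definite description, so existence and uniqueness are both
  shown. The representing vector is assembled from the values of the derivative on the
  basis.\<close>

lemma GDERIV_gradient:
  fixes f :: "'a::euclidean_space \<Rightarrow> real"
  assumes "f differentiable (at x)"
  shows "GDERIV f x :> gradient f x"
proof -
  obtain f' where f': "(f has_derivative f') (at x)"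
    using assms by (auto simp: differentiable_def)
  then have lin: "linear f'"
    by (rule has_derivative_linear)
  define g where "g = (\<Sum>b\<in>Basis. f' b *\<^sub>R b)"
  have "f' h = h \<bullet> g" for h
  proof -
    have "f' h = f' (\<Sum>b\<in>Basis. (h \<bullet> b) *\<^sub>R b)"
      by (simp add: euclidean_representation)
    also have "\<dots> = (\<Sum>b\<in>Basis. (h \<bullet> b) * f' b)"
      using lin by (simp add: linear_sum linear_scale)
    finally show ?thesis
      by (simp add: g_def inner_sum_right mult.commute)
  qed
  then have "f' = (\<lambda>h. h \<bullet> g)"
    by auto
  then have g: "GDERIV f x :> g"
    using f' by (simp add: gderiv_def)
  have "g' = g" if "GDERIV f x :> g'" for g'
  proof -
    have "(\<lambda>h. h \<bullet> g') = (\<lambda>h. h \<bullet> g)"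
      using that g unfolding gderiv_def by (rule has_derivative_unique)
    then show ?thesis
      by (metis vector_eq_ldot)
  qed
  then show ?thesis
    unfolding gradient_def using g by (rule theI[where P = "\<lambda>D. GDERIV f x :> D", rotated]) 
qed

lemma GDERIV_line:
  assumes "GDERIV f (x + r *\<^sub>R t) :> g"
  shows "((\<lambda>r. f (x + r *\<^sub>R t)) has_real_derivative g \<bullet> t) (at r)"
proof -
  have "((\<lambda>r. x + r *\<^sub>R t) has_derivative (\<lambda>u. u *\<^sub>R t)) (at r)"
    by (auto intro!: derivative_eq_intros)
  then have "((\<lambda>r. f (x + r *\<^sub>R t)) has_derivative (\<lambda>u. (u *\<^sub>R t) \<bullet> g)) (at r)"
    using assms unfolding gderiv_def by (rule has_derivative_compose)
  then show ?thesis
    by (simp add: has_field_derivative_def inner_commute mult.commute[of "g \<bullet> t"] mult_commute_abs)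
qed

text \<open>Along the line through \<open>x\<close> and \<open>y\<close> this is the tangent
  inequality for convex functions of one real variable.\<close>

lemma convex_on_above_tangent:
  fixes f :: "'a::real_inner \<Rightarrow> real"
  assumes conv: "convex_on UNIV f" and g: "GDERIV f x :> g"
  shows "f x + g \<bullet> (y - x) \<le> f y"
proof -
  let ?l = "\<lambda>r. x + r *\<^sub>R (y - x)"
  have "convex_on UNIV (\<lambda>r. f (?l r))"
  proof (rule convex_onI)
    fix t r r' :: real assume t: "0 < t" "t < 1"
    have "?l ((1 - t) *\<^sub>R r + t *\<^sub>R r') = (1 - t) *\<^sub>R ?l r + t *\<^sub>R ?l r'"
      by (simp add: algebra_simps)
    then show "f (?l ((1 - t) *\<^sub>R r + t *\<^sub>R r')) \<le> (1 - t) * f (?l r) + t * f (?l r')"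
      using convex_onD[OF conv, of t "?l r" "?l r'"] t by simp
  qed simp
  moreover have "((\<lambda>r. f (?l r)) has_real_derivative g \<bullet> (y - x)) (at 0)"
    using g by (intro GDERIV_line) simp
  ultimately have "f (?l 1) - f (?l 0) \<ge> (g \<bullet> (y - x)) * (1 - 0)"
    using convex_on_imp_above_tangent[of UNIV "\<lambda>r. f (?l r)" 0 1 "g \<bullet> (y - x)"] by simp
  then show ?thesis
    by simp
qed

text \<open>Half of the equivalence of norms in finite dimension: \<open>nrm\<close> is Lipschitz,
  hence attains a positive minimum on the compact unit sphere of \<open>S\<close>. It makes the unit
  ball in \<open>conj_norm\<close> bounded.\<close>

lemma is_norm_on_dominates_norm:
  fixes S :: "'a::euclidean_space set"
  assumes S: "subspace S" and nrm: "is_norm_on S nrm"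
  obtains c where "0 < c" "\<And>t. t \<in> S \<Longrightarrow> c * norm t \<le> nrm t"
proof -
  have nonneg: "0 \<le> nrm t" and zero: "nrm t = 0 \<longleftrightarrow> t = 0" if "t \<in> S" for t
    using nrm that by (auto simp: is_norm_on_def)
  have scale: "nrm (a *\<^sub>R t) = \<bar>a\<bar> * nrm t" if "t \<in> S" for t a
    using nrm that by (auto simp: is_norm_on_def)
  have tri: "nrm (t + u) \<le> nrm t + nrm u" if "t \<in> S" "u \<in> S" for t u
    using nrm that by (auto simp: is_norm_on_def)
  obtain B where B: "B \<subseteq> S" "pairwise orthogonal B" "\<And>x. x \<in> B \<Longrightarrow> norm x = 1"
      "independent B" "span B = S"
    using orthonormal_basis_subspace[OF S] by metis
  have finB: "finite B"
    using B(4) by (rule independent_imp_finite)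
  define M where "M = (\<Sum>b\<in>B. nrm b)"
  have M: "0 \<le> M"
    unfolding M_def using B nonneg by (intro sum_nonneg) auto
  have upper: "nrm t \<le> M * norm t" if t: "t \<in> S" for t
  proof -
    have "t = (\<Sum>b\<in>B. (t \<bullet> b) *\<^sub>R b)"
      using orthonormal_basis_expand[OF B(2,3) _ finB, of t] t B(5) by simp
    moreover have "nrm (\<Sum>b\<in>A. (t \<bullet> b) *\<^sub>R b) \<le> (\<Sum>b\<in>A. nrm b) * norm t" if "A \<subseteq> B" for A
      using finite_subset[OF that finB] that
    proof (induction A)
      case empty
      then show ?case using zero[of 0] subspace_0[OF S] by simp
    next
      case (insert b A)
      have bS: "b \<in> S" and "A \<subseteq> S"
        using insert B by auto
      then have AS: "(\<Sum>b\<in>A. (t \<bullet> b) *\<^sub>R b) \<in> S"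
        using S by (intro subspace_sum) (auto intro: subspace_scale)
      have "nrm ((t \<bullet> b) *\<^sub>R b) \<le> nrm b * norm t"
        using scale[OF bS] Cauchy_Schwarz_ineq2[of t b] B(3)[of b] insert nonneg[OF bS]
          mult_left_mono[of "\<bar>t \<bullet> b\<bar>" "norm t" "nrm b"]
        by (simp add: mult.commute)
      moreover have "nrm ((t \<bullet> b) *\<^sub>R b + (\<Sum>b\<in>A. (t \<bullet> b) *\<^sub>R b)) \<le>
          nrm ((t \<bullet> b) *\<^sub>R b) + nrm (\<Sum>b\<in>A. (t \<bullet> b) *\<^sub>R b)"
        using bS AS S by (intro tri) (auto intro: subspace_scale)
      ultimately show ?case
        using insert by (simp add: distrib_right)
    qed
    ultimately show ?thesis
      using M_def by (metis order_refl)
  qed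
  have "\<bar>nrm t - nrm u\<bar> \<le> M * norm (t - u)" if t: "t \<in> S" "u \<in> S" for t u
  proof -
    have d: "t - u \<in> S" "u - t \<in> S"
      using S t by (auto intro: subspace_diff)
    have "nrm (u - t) = nrm (t - u)"
      using scale[OF d(1), of "-1"] by simp
    then show ?thesis
      using tri[OF d(1) t(2)] tri[OF d(2) t(1)] upper[OF d(1)] by simp
  qed
  then have "M-lipschitz_on S nrm"
    using M by (intro lipschitz_onI) (auto simp: dist_norm)
  then have cont: "continuous_on S nrm"
    by (rule lipschitz_on_continuous_on)
  let ?K = "sphere 0 1 \<inter> S"
  have comp: "compact ?K"
    using closed_subspace[OF S] by (intro compact_Int_closed) auto
  show ?thesis
  proof (cases "?K = {}")
    \<comment> \<open>Here \<open>S = {0}\<close>, and any positive constant serves.\<close>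
    case True
    have "t = 0" if "t \<in> S" for t
    proof (rule ccontr)
      assume "t \<noteq> 0"
      then have "(1 / norm t) *\<^sub>R t \<in> ?K"
        using that S by (auto intro: subspace_scale)
      then show False using True by blast
    qed
    then show ?thesis
      using that[of 1] zero by force
  next
    case False
    then obtain u where u: "u \<in> ?K" "\<And>t. t \<in> ?K \<Longrightarrow> nrm u \<le> nrm t"
      using continuous_attains_inf[OF comp, of nrm] cont by (meson continuous_on_subset inf_le2)
    have "nrm u * norm t \<le> nrm t" if t: "t \<in> S" for t
    proof (cases "t = 0")
      case False
      then have "(1 / norm t) *\<^sub>R t \<in> ?K"
        using t S by (auto intro: subspace_scale)
      from u(2)[OF this] show ?thesis
        using scale[OF t] False by (simp add: field_simps)
    qed (use nonneg t in auto)
    moreover have "0 < nrm u"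
      using u(1) nonneg[of u] zero[of u] by (cases "u = 0") auto
    ultimately show ?thesis
      using that by blast
  qed
qed

text \<open>A real supremum is informative only for a set bounded above, which the equivalence of
  norms ensures. What remains is the definition tested at \<open>t\<close> scaled to norm 1.\<close>

lemma inner_le_conj_norm:
  fixes S :: "'a::euclidean_space set"
  assumes S: "subspace S" and nrm: "is_norm_on S nrm" and t: "t \<in> S"
  shows "g \<bullet> t \<le> conj_norm S nrm g * nrm t"
proof (cases "t = 0")
  case True
  then show ?thesis using nrm t by (auto simp: is_norm_on_def)
next
  case False
  have pos: "0 < nrm t"
    using nrm t False by (auto simp: is_norm_on_def less_le)
  obtain c where c: "0 < c" "\<And>t. t \<in> S \<Longrightarrow> c * norm t \<le> nrm t"
    using is_norm_on_dominates_norm[OF S nrm] by blast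
  have "bdd_above ((\<lambda>s. s \<bullet> g) ` {s \<in> S. nrm s \<le> 1})"
  proof (rule bdd_aboveI2)
    fix s assume "s \<in> {s \<in> S. nrm s \<le> 1}"
    then have "norm s \<le> 1 / c"
      using c(1) c(2)[of s] by (auto simp: field_simps)
    then have "norm s * norm g \<le> 1 / c * norm g"
      by (rule mult_right_mono) simp
    then show "s \<bullet> g \<le> 1 / c * norm g"
      using norm_cauchy_schwarz[of s g] by linarith
  qed
  moreover have "(1 / nrm t) *\<^sub>R t \<in> {s \<in> S. nrm s \<le> 1}"
    using nrm t S pos by (auto simp: is_norm_on_def intro: subspace_scale)
  ultimately have "((1 / nrm t) *\<^sub>R t) \<bullet> g \<le> conj_norm S nrm g"
    unfolding conj_norm_def by (intro cSUP_upper2[OF _ _ order_refl])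
  then show ?thesis
    using pos by (simp add: field_simps inner_commute)
qed

text \<open>The claim is \<open>?\<phi> 1 \<le> ?\<phi> 0\<close>, where \<open>?\<phi>\<close>
  subtracts the linear and quadratic models from \<open>f\<close> along the segment;
  \<open>lip\<close> makes its derivative nonpositive.\<close>

lemma lipschitz_gradient_upper_bound:
  fixes f :: "'a::euclidean_space \<Rightarrow> real"
  assumes diff: "\<And>y. f differentiable (at y)"
    and lip: "\<And>r. 0 \<le> r \<Longrightarrow> (gradient f (y + r *\<^sub>R t) - gradient f y) \<bullet> t \<le> r * M"
  shows "f (y + t) \<le> f y + gradient f y \<bullet> t + M / 2"
proof -
  let ?\<phi> = "\<lambda>r. f (y + r *\<^sub>R t) - r * (gradient f y \<bullet> t) - r\<^sup>2 * (M / 2)"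
  have "\<exists>d. (?\<phi> has_real_derivative d) (at r) \<and> d \<le> 0" if "0 \<le> r" for r
  proof -
    have "(?\<phi> has_real_derivative gradient f (y + r *\<^sub>R t) \<bullet> t - gradient f y \<bullet> t - r * M) (at r)"
      by (auto intro!: derivative_eq_intros GDERIV_line GDERIV_gradient diff)
    then show ?thesis
      using lip[OF that] by (force simp: inner_diff_left)
  qed
  then have "?\<phi> 1 \<le> ?\<phi> 0"
    by (intro DERIV_nonpos_imp_nonincreasing[of 0 1]) auto
  then show ?thesis
    by simp
qed

text \<open>Projecting the point \<open>(z, \<Omega> z - \<delta>)\<close> onto the epigraph replaces subgradients at \<open>z\<close>, which need
  not exist when \<open>z\<close> is on the relative boundary of the domain.\<close>

lemma approximate_subgradient:
  fixes \<Omega> :: "'a::euclidean_space \<Rightarrow> ereal"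
  assumes S: "subspace S" and conv: "convex (ereal_epigraph S \<Omega>)" and clos: "closed (ereal_epigraph S \<Omega>)"
    and z: "z \<in> S" "\<Omega> z = ereal \<omega>" and \<delta>: "0 < \<delta>"
  obtains y g where "y \<in> S" "g \<in> S" "\<Omega> y < \<infinity>" "ereal (\<omega> - \<delta>) \<le> \<Omega> y" "0 \<le> g \<bullet> (z - y)"
    "\<And>u. u \<in> S \<Longrightarrow> \<Omega> y + ereal (g \<bullet> (u - y)) \<le> \<Omega> u"
proof -
  let ?E = "ereal_epigraph S \<Omega>"
  have zE: "(z, \<omega>) \<in> ?E" and notE: "(z, \<omega> - \<delta>) \<notin> ?E"
    using z \<delta> by (auto simp: ereal_epigraph_def)
  have "?E \<noteq> {}"
    using zE by auto
  from distance_attains_inf[OF clos this, of "(z, \<omega> - \<delta>)"]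
  obtain p where p: "p \<in> ?E" "\<And>e. e \<in> ?E \<Longrightarrow> dist (z, \<omega> - \<delta>) p \<le> dist (z, \<omega> - \<delta>) e"
    by metis
  obtain y r where yr: "p = (y, r)"
    by (cases p)
  have yS: "y \<in> S" and \<Omega>y: "\<Omega> y \<le> ereal r"
    using p(1) by (auto simp: yr ereal_epigraph_def)
  \<comment> \<open>The outer normal of the epigraph at the projection, split into its horizontal
    part \<open>a\<close> and its vertical part \<open>b\<close>.\<close>
  define a b where "a = z - y" and "b = \<omega> - \<delta> - r"
  have proj: "a \<bullet> (u - y) + b * (q - r) \<le> 0" if "u \<in> S" "\<Omega> u \<le> ereal q" for u q
  proof -
    have "(u, q) \<in> ?E"
      using that by (simp add: ereal_epigraph_def)
    then show ?thesis
      using any_closest_point_dot[OF conv clos p(1) _ ballI[OF p(2)], of "(u, q)"] by (simp add: yr a_def b_def)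
  qed
  \<comment> \<open>The epigraph extends upwards without bound, so the normal cannot point
    up.\<close>
  have "b \<le> 0"
    using proj[OF yS, of "r + 1"] \<Omega>y by (simp add: order_trans[of "\<Omega> y" "ereal r"])
  have ab: "a \<bullet> a + b\<^sup>2 + b * \<delta> \<le> 0"
    using proj[OF z(1), of \<omega>] z by (simp add: a_def b_def power2_eq_square algebra_simps)
  \<comment> \<open>A horizontal normal would force \<open>a = 0\<close>, and the projected point
    would already lie in the epigraph.\<close>
  have "b \<noteq> 0"
  proof
    assume "b = 0"
    then have "a \<bullet> a \<le> 0"
      using ab by simp
    then have "\<not> 0 < a \<bullet> a"
      by (simp only: not_less)
    then have "a = 0"
      by (simp only: inner_gt_zero_iff not_not)
    then have "p = (z, \<omega> - \<delta>)"
      using \<open>b = 0\<close> by (simp add: yr a_def b_def)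
    then show False
      using p(1) notE by simp
  qed
  with \<open>b \<le> 0\<close> have b: "b < 0"
    by simp
  \<comment> \<open>Dividing by the vertical part turns the normal into a slope.\<close>
  define g where "g = (1 / (- b)) *\<^sub>R a"
  have sub: "r + g \<bullet> (u - y) \<le> q" if "u \<in> S" "\<Omega> u \<le> ereal q" for u q
    using proj[OF that] b by (simp add: g_def field_simps)
  \<comment> \<open>The projection lies on the graph: \<open>sub\<close> at \<open>u = y\<close>
    excludes points of the epigraph below height \<open>r\<close> over \<open>y\<close>.\<close>
  have ry: "\<Omega> y = ereal r"
  proof (rule antisym[OF \<Omega>y], rule ccontr)
    assume "\<not> ereal r \<le> \<Omega> y"
    then obtain q where "\<Omega> y < ereal q" "ereal q < ereal r"
      using ereal_dense2[of "\<Omega> y" "ereal r"] by (auto simp: not_le)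
    then show False
      using sub[OF yS, of q] by (auto dest: less_imp_le)
  qed
  show ?thesis
  proof (rule that)
    show "y \<in> S" "\<Omega> y < \<infinity>"
      using yS ry by simp_all
    show "g \<in> S"
      using S yS z by (auto simp: g_def a_def intro!: subspace_neg subspace_scale subspace_diff)
    have "b * (b + \<delta>) = b\<^sup>2 + b * \<delta>"
      by (simp add: power2_eq_square distrib_left)
    then have "b * (b + \<delta>) \<le> 0"
      using ab inner_ge_zero[of a] by linarith
    then have "\<omega> - \<delta> \<le> r"
      using b by (simp add: b_def)
    then show "ereal (\<omega> - \<delta>) \<le> \<Omega> y"
      using ry by simp
    show "0 \<le> g \<bullet> (z - y)"
      using b by (simp add: g_def a_def[symmetric] divide_nonneg_neg)
    show "\<Omega> y + ereal (g \<bullet> (u - y)) \<le> \<Omega> u" if u: "u \<in> S" for u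
    proof (rule ereal_le_real)
      fix q assume "\<Omega> u \<le> ereal q"
      then show "\<Omega> y + ereal (g \<bullet> (u - y)) \<le> ereal q"
        using sub[OF u] ry by simp
    qed
  qed
qed

section \<open>Block separable regularizers\<close>

lemma subspace_block_space: "subspace (block_space blk i)"
  by (auto simp: subspace_def block_space_def)

lemma block_in_block_space: "block blk i y \<in> block_space blk i"
  by (simp add: block_def block_space_def)

lemma linear_block: "linear (block blk i)"
  by (rule linearI) (auto simp: block_def vec_eq_iff)

lemma block_add: "block blk i (y + z) = block blk i y + block blk i z"
  by (rule linear_add[OF linear_block])

lemma block_diff: "block blk i (y - z) = block blk i y - block blk i z"
  by (rule linear_diff[OF linear_block])

lemma block_scaleR: "block blk i (r *\<^sub>R y) = r *\<^sub>R block blk i y"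
  by (rule linear_scale[OF linear_block])

lemma block_block_space:
  "t \<in> block_space blk j \<Longrightarrow> block blk i t = (if i = j then t else 0)"
  by (auto simp: block_def block_space_def vec_eq_iff)

lemma block_sum_block_space:
  assumes "finite A" "\<And>j. j \<in> A \<Longrightarrow> d j \<in> block_space blk j"
  shows "block blk i (\<Sum>j\<in>A. d j) = (if i \<in> A then d i else 0)"
proof -
  have "block blk i (\<Sum>j\<in>A. d j) = (\<Sum>j\<in>A. block blk i (d j))"
    by (rule linear_sum[OF linear_block])
  also have "\<dots> = (\<Sum>j\<in>A. if i = j then d j else 0)"
    using assms(2) by (intro sum.cong) (auto simp: block_block_space)
  finally show ?thesis
    using assms(1) by simp
qed

lemma inner_block:
  assumes "t \<in> block_space blk i"
  shows "block blk i g \<bullet> t = g \<bullet> t"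
  using assms unfolding inner_vec_def block_def block_space_def by (intro sum.cong) auto

lemma sum_block:
  assumes "finite A" "\<And>j. blk j \<in> A"
  shows "(\<Sum>i\<in>A. block blk i y) = y"
  using assms by (simp add: vec_eq_iff block_def)

text \<open>The definition of strong convexity quantifies over subgradients; convexity makes the
  gradient one of them.\<close>

lemma gradient_strong_convexity:
  fixes f :: "'a::euclidean_space \<Rightarrow> real"
  assumes conv: "convex_on UNIV f" and diff: "f differentiable (at z)"
    and strong: "strongly_convex_wrt N (\<lambda>y. ereal (f y)) \<mu>"
  shows "f z + gradient f z \<bullet> (y - z) + \<mu> / 2 * (N (y - z))\<^sup>2 \<le> f y"
proof -
  have "gradient f z \<in> subdifferential (\<lambda>y. ereal (f y)) z"
    using convex_on_above_tangent[OF conv GDERIV_gradient[OF diff]] by (simp add: subdifferential_def)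
  then show ?thesis
    using strong by (simp add: strongly_convex_wrt_def eff_dom_def add.assoc)
qed

locale block_separable_regularizer =
  fixes n :: nat and blk :: "'m::finite \<Rightarrow> nat" and nrm :: "nat \<Rightarrow> real ^ 'm \<Rightarrow> real"
    and w :: "nat \<Rightarrow> real" and \<Omega> :: "nat \<Rightarrow> real ^ 'm \<Rightarrow> ereal"
  assumes blocks: "\<And>j. blk j \<in> {1..n}"
    and norms: "\<And>i. i \<in> {1..n} \<Longrightarrow> is_norm_on (block_space blk i) (nrm i)"
    and w_pos: "\<And>i. i \<in> {1..n} \<Longrightarrow> 0 < w i"
    and Omega_no_minf: "\<And>i t. i \<in> {1..n} \<Longrightarrow> t \<in> block_space blk i \<Longrightarrow> \<Omega> i t \<noteq> - \<infinity>"
    and Omega_convex: "\<And>i. i \<in> {1..n} \<Longrightarrow> convex (ereal_epigraph (block_space blk i) (\<Omega> i))"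
    and Omega_closed: "\<And>i. i \<in> {1..n} \<Longrightarrow> closed (ereal_epigraph (block_space blk i) (\<Omega> i))"
begin

abbreviation "bl \<equiv> block blk"

text \<open>\<open>real_of_ereal\<close> sends infinite values to 0, so \<open>\<omega>\<close> is
  meaningful only where \<open>\<Omega> i\<close> is finite, and \<open>R\<close> only on
  \<open>feasible\<close>.\<close>

definition \<omega> :: "nat \<Rightarrow> real ^ 'm \<Rightarrow> real" where "\<omega> i t = real_of_ereal (\<Omega> i t)"

definition R :: "real ^ 'm \<Rightarrow> real" where "R y = (\<Sum>i\<in>{1..n}. \<omega> i (bl i y))"

definition feasible :: "(real ^ 'm) set" where "feasible = {y. \<forall>i\<in>{1..n}. \<Omega> i (bl i y) < \<infinity>}"

text \<open>The square of \<open>wnorm\<close>, which unlike the norm itself is additive over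
  blocks.\<close>

definition q :: "real ^ 'm \<Rightarrow> real" where "q v = (\<Sum>i\<in>{1..n}. w i * (nrm i (bl i v))\<^sup>2)"

lemma Omega_real:
  assumes "i \<in> {1..n}" "t \<in> block_space blk i" "\<Omega> i t < \<infinity>"
  shows "\<Omega> i t = ereal (\<omega> i t)"
  using assms Omega_no_minf[of i t] by (cases "\<Omega> i t") (auto simp: \<omega>_def)

lemma separable_real: "y \<in> feasible \<Longrightarrow> block_separable blk n \<Omega> y = ereal (R y)"
  unfolding block_separable_def R_def feasible_def
  by (simp add: Omega_real block_in_block_space flip: sum_ereal)

lemma separable_infinite:
  assumes "y \<notin> feasible"
  shows "block_separable blk n \<Omega> y = \<infinity>"
proof -
  have "\<exists>i\<in>{1..n}. \<Omega> i (bl i y) = \<infinity>"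
    using assms by (auto simp: feasible_def)
  moreover have "\<forall>i\<in>{1..n}. \<Omega> i (bl i y) \<noteq> -\<infinity>"
    using Omega_no_minf block_in_block_space by blast
  ultimately show ?thesis
    unfolding block_separable_def by (subst sum_Pinfty) auto
qed

lemma eff_dom_separable: "eff_dom (block_separable blk n \<Omega>) = feasible"
proof -
  have "y \<in> eff_dom (block_separable blk n \<Omega>) \<longleftrightarrow> y \<in> feasible" for y
    by (cases "y \<in> feasible") (simp_all add: eff_dom_def separable_real separable_infinite)
  then show ?thesis by blast
qed

lemma q_nonneg: "0 \<le> q v"
  unfolding q_def using w_pos by (intro sum_nonneg) (auto simp: less_imp_le)

lemma wnorm_power2: "(wnorm blk n nrm w v)\<^sup>2 = q v"
  using q_nonneg[of v] by (simp add: wnorm_def q_def)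

lemma norm_scaleR:
  assumes "i \<in> {1..n}" "t \<in> block_space blk i"
  shows "nrm i (r *\<^sub>R t) = \<bar>r\<bar> * nrm i t"
  using norms[OF assms(1)] assms(2) by (simp add: is_norm_on_def)

lemma q_scaleR: "q (r *\<^sub>R v) = r\<^sup>2 * q v"
  unfolding q_def sum_distrib_left
  by (intro sum.cong) (auto simp: block_scaleR norm_scaleR block_in_block_space power_mult_distrib)

lemma q_sum_block_space:
  assumes "\<And>i. i \<in> {1..n} \<Longrightarrow> d i \<in> block_space blk i"
  shows "q (\<Sum>i\<in>{1..n}. d i) = (\<Sum>i\<in>{1..n}. w i * (nrm i (d i))\<^sup>2)"
  unfolding q_def
proof (rule sum.cong[OF refl])
  fix i assume "i \<in> {1..n}"
  then have "bl i (\<Sum>j\<in>{1..n}. d j) = d i"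
    using assms by (subst block_sum_block_space) auto
  then show "w i * (nrm i (bl i (\<Sum>j\<in>{1..n}. d j)))\<^sup>2 = w i * (nrm i (d i))\<^sup>2"
    by simp
qed

text \<open>General norms have no parallelogram identity. The triangle inequality
  \<open>D \<le> A + B\<close> together with \<open>a * (1 - a) * (A + B)\<^sup>2 = a * A\<^sup>2 +
  (1 - a) * B\<^sup>2 - (a * A - (1 - a) * B)\<^sup>2\<close> replaces it. The reference point
  \<open>y\<close> is free because an approximate subgradient need not sit at the convex
  combination.\<close>

lemma q_interpolate:
  assumes a: "0 \<le> a" "a \<le> 1"
  shows "a * (1 - a) * q (u - v) \<le> a * q (u - y) + (1 - a) * q (v - y)"
proof -
  have "a * (1 - a) * (w i * (nrm i (bl i (u - v)))\<^sup>2) \<le>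
      a * (w i * (nrm i (bl i (u - y)))\<^sup>2) + (1 - a) * (w i * (nrm i (bl i (v - y)))\<^sup>2)"
    if i: "i \<in> {1..n}" for i
  proof -
    let ?A = "nrm i (bl i (u - y))" and ?B = "nrm i (bl i (v - y))" and ?D = "nrm i (bl i (u - v))"
    have minus: "nrm i (- bl i (v - y)) = ?B"
      using norm_scaleR[OF i block_in_block_space, of "-1" "v - y"] by simp
    have "bl i (u - v) = bl i (u - y) + - bl i (v - y)"
      by (simp add: block_diff)
    moreover have "- bl i (v - y) \<in> block_space blk i"
      using block_in_block_space subspace_block_space by (rule subspace_neg[rotated])
    ultimately have "?D \<le> ?A + ?B"
      using norms[OF i] block_in_block_space[of blk i "u - y"] minus unfolding is_norm_on_def by metis
    moreover have "0 \<le> ?D"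
      using norms[OF i] block_in_block_space unfolding is_norm_on_def by blast
    ultimately have "?D\<^sup>2 \<le> (?A + ?B)\<^sup>2"
      by (rule power_mono)
    then have "a * (1 - a) * ?D\<^sup>2 \<le> a * (1 - a) * (?A + ?B)\<^sup>2"
      using a by (intro mult_left_mono) auto
    also have "\<dots> = a * ?A\<^sup>2 + (1 - a) * ?B\<^sup>2 - (a * ?A - (1 - a) * ?B)\<^sup>2"
      by (simp add: power2_eq_square algebra_simps)
    also have "\<dots> \<le> a * ?A\<^sup>2 + (1 - a) * ?B\<^sup>2"
      by simp
    finally have "w i * (a * (1 - a) * ?D\<^sup>2) \<le> w i * (a * ?A\<^sup>2 + (1 - a) * ?B\<^sup>2)"
      using w_pos[OF i] by (intro mult_left_mono) auto
    then show ?thesis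
      by (simp add: algebra_simps)
  qed
  then show ?thesis
    unfolding q_def sum_distrib_left sum.distrib[symmetric] by (rule sum_mono)
qed

lemma convex_combination_in_dom:
  assumes uv: "u \<in> feasible" "v \<in> feasible" and a: "0 \<le> a" "a \<le> 1"
  shows "a *\<^sub>R u + (1 - a) *\<^sub>R v \<in> feasible"
proof -
  have "\<Omega> i (bl i (a *\<^sub>R u + (1 - a) *\<^sub>R v)) < \<infinity>" if i: "i \<in> {1..n}" for i
  proof -
    have "(bl i y, \<omega> i (bl i y)) \<in> ereal_epigraph (block_space blk i) (\<Omega> i)" if "y \<in> feasible" for y
      using that i Omega_real[OF i block_in_block_space, of y]
      by (simp add: ereal_epigraph_def block_in_block_space feasible_def)
    then have "a *\<^sub>R (bl i u, \<omega> i (bl i u)) + (1 - a) *\<^sub>R (bl i v, \<omega> i (bl i v))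
        \<in> ereal_epigraph (block_space blk i) (\<Omega> i)"
      using uv a by (intro convexD[OF Omega_convex[OF i]]) auto
    then show ?thesis
      by (auto simp: ereal_epigraph_def block_add block_scaleR)
  qed
  then show ?thesis
    by (simp add: feasible_def)
qed

text \<open>Passes from subgradients to an inequality along segments. The strong subgradient
  inequality at an auxiliary point \<open>y\<close> is averaged over \<open>u\<close> and
  \<open>v\<close>; \<open>0 \<le> g \<bullet> (?z - y)\<close> and
  \<open>R ?z - real n * \<delta> \<le> R y\<close> transfer the result from \<open>y\<close> to
  \<open>?z\<close>, and \<open>q_interpolate\<close> treats the quadratic terms.\<close>

lemma separable_strong_convexity:
  assumes strong: "strongly_convex_wrt (wnorm blk n nrm w) (block_separable blk n \<Omega>) \<mu>"
    and uv: "u \<in> feasible" "v \<in> feasible" and a: "0 \<le> a" "a \<le> 1"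
  shows "R (a *\<^sub>R u + (1 - a) *\<^sub>R v) \<le> a * R u + (1 - a) * R v - \<mu> / 2 * (a * (1 - a) * q (u - v))"
proof -
  let ?z = "a *\<^sub>R u + (1 - a) *\<^sub>R v"
  have \<mu>: "0 \<le> \<mu>"
    using strong by (simp add: strongly_convex_wrt_def)
  have zdom: "?z \<in> feasible"
    using uv a by (rule convex_combination_in_dom)
  \<comment> \<open>Approximation is done block by block, each block costing
    \<open>\<delta>\<close>, which is made arbitrarily small at the end.\<close>
  have approx: "R ?z - real n * \<delta> \<le> a * R u + (1 - a) * R v - \<mu> / 2 * (a * (1 - a) * q (u - v))"
    if \<delta>: "0 < \<delta>" for \<delta>
  proof -
    let ?P = "\<lambda>i yi gi. yi \<in> block_space blk i \<and> gi \<in> block_space blk i \<and> \<Omega> i yi < \<infinity> \<and>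
        \<omega> i (bl i ?z) - \<delta> \<le> \<omega> i yi \<and> 0 \<le> gi \<bullet> (bl i ?z - yi) \<and>
        (\<forall>t\<in>block_space blk i. \<Omega> i yi + ereal (gi \<bullet> (t - yi)) \<le> \<Omega> i t)"
    have "\<exists>yi gi. ?P i yi gi" if i: "i \<in> {1..n}" for i
    proof -
      have "\<Omega> i (bl i ?z) = ereal (\<omega> i (bl i ?z))"
        using zdom i by (intro Omega_real block_in_block_space) (auto simp: feasible_def)
      from approximate_subgradient[OF subspace_block_space Omega_convex[OF i] Omega_closed[OF i]
          block_in_block_space this \<delta>]
      obtain yi gi where "yi \<in> block_space blk i" "gi \<in> block_space blk i" "\<Omega> i yi < \<infinity>"
        "ereal (\<omega> i (bl i ?z) - \<delta>) \<le> \<Omega> i yi" "0 \<le> gi \<bullet> (bl i ?z - yi)"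
        "\<forall>t\<in>block_space blk i. \<Omega> i yi + ereal (gi \<bullet> (t - yi)) \<le> \<Omega> i t"
        by metis
      moreover from this have "\<omega> i (bl i ?z) - \<delta> \<le> \<omega> i yi"
        using Omega_real[OF i, of yi] by (metis ereal_less_eq(3))
      ultimately show ?thesis
        by blast
    qed
    then obtain yb gb where P: "\<And>i. i \<in> {1..n} \<Longrightarrow> ?P i (yb i) (gb i)"
      by metis
    define y g where "y = (\<Sum>i\<in>{1..n}. yb i)" and "g = (\<Sum>i\<in>{1..n}. gb i)"
    have bl_y: "bl i y = yb i" if "i \<in> {1..n}" for i
      unfolding y_def using P that by (subst block_sum_block_space) auto
    have ydom: "y \<in> feasible"
      using P by (simp add: feasible_def bl_y)
    have g_inner: "g \<bullet> (t - y) = (\<Sum>i\<in>{1..n}. gb i \<bullet> (bl i t - yb i))" for t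
    proof -
      have "gb i \<bullet> (t - y) = gb i \<bullet> (bl i t - yb i)" if "i \<in> {1..n}" for i
        using inner_block[of "gb i" blk i "t - y"] P[OF that] bl_y[OF that]
        by (simp add: block_diff inner_commute)
      then show ?thesis
        by (simp add: g_def inner_sum_left)
    qed
    have sub: "R y + g \<bullet> (t - y) \<le> R t" if t: "t \<in> feasible" for t
    proof -
      have "\<omega> i (yb i) + gb i \<bullet> (bl i t - yb i) \<le> \<omega> i (bl i t)" if i: "i \<in> {1..n}" for i
      proof -
        have "\<Omega> i (bl i t) = ereal (\<omega> i (bl i t))" "\<Omega> i (yb i) = ereal (\<omega> i (yb i))"
          using t i P[OF i] by (auto intro!: Omega_real block_in_block_space simp: feasible_def)
        moreover have "\<Omega> i (yb i) + ereal (gb i \<bullet> (bl i t - yb i)) \<le> \<Omega> i (bl i t)"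
          using P[OF i] block_in_block_space by blast
        ultimately show ?thesis
          by simp
      qed
      then have "(\<Sum>i\<in>{1..n}. \<omega> i (yb i) + gb i \<bullet> (bl i t - yb i)) \<le> R t"
        unfolding R_def by (rule sum_mono)
      moreover have "R y = (\<Sum>i\<in>{1..n}. \<omega> i (yb i))"
        unfolding R_def using bl_y by simp
      ultimately show ?thesis
        by (simp add: g_inner sum.distrib)
    qed
    have "g \<in> subdifferential (block_separable blk n \<Omega>) y"
      unfolding subdifferential_def
    proof (intro CollectI allI)
      fix t
      show "block_separable blk n \<Omega> y + ereal (g \<bullet> (t - y)) \<le> block_separable blk n \<Omega> t"
        using sub[of t] by (cases "t \<in> feasible") (simp_all add: separable_real ydom separable_infinite)
    qed
    then have lower: "R y + g \<bullet> (t - y) + \<mu> / 2 * q (t - y) \<le> R t" if "t \<in> feasible" for t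
      using strong that ydom
      unfolding strongly_convex_wrt_def eff_dom_separable wnorm_power2
      by (force simp: separable_real add.assoc)
    have "g \<bullet> (?z - y) = a * (g \<bullet> (u - y)) + (1 - a) * (g \<bullet> (v - y))"
      by (simp add: inner_diff_right inner_add_right algebra_simps)
    then have "R y + g \<bullet> (?z - y) + \<mu> / 2 * (a * q (u - y) + (1 - a) * q (v - y)) =
        a * (R y + g \<bullet> (u - y) + \<mu> / 2 * q (u - y)) + (1 - a) * (R y + g \<bullet> (v - y) + \<mu> / 2 * q (v - y))"
      by (simp add: field_simps)
    also have "\<dots> \<le> a * R u + (1 - a) * R v"
      using lower uv a by (intro add_mono mult_left_mono) auto
    finally have "R y + g \<bullet> (?z - y) + \<mu> / 2 * (a * q (u - y) + (1 - a) * q (v - y)) \<le> a * R u + (1 - a) * R v" .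
    moreover have "0 \<le> g \<bullet> (?z - y)"
      unfolding g_inner using P by (intro sum_nonneg) blast
    moreover have "\<mu> / 2 * (a * (1 - a) * q (u - v)) \<le> \<mu> / 2 * (a * q (u - y) + (1 - a) * q (v - y))"
      using \<mu> q_interpolate[OF a] by (intro mult_left_mono) auto
    moreover have "R ?z - real n * \<delta> \<le> R y"
    proof -
      have "R ?z - real n * \<delta> = (\<Sum>i\<in>{1..n}. \<omega> i (bl i ?z) - \<delta>)"
        by (simp add: R_def sum_subtractf)
      also have "\<dots> \<le> R y"
        unfolding R_def using P bl_y by (intro sum_mono) auto
      finally show ?thesis .
    qed
    ultimately show ?thesis
      by linarith
  qed
  show ?thesis
  proof (rule field_le_epsilon)
    fix e :: real assume "0 < e"
    have "0 < n"
      using blocks[of undefined] by auto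
    then show "R ?z \<le> a * R u + (1 - a) * R v - \<mu> / 2 * (a * (1 - a) * q (u - v)) + e"
      using approx[of "e / real n"] \<open>0 < e\<close> by simp
  qed
qed

section \<open>Curvature comparison and decrease in one step\<close>

lemma inner_sum_blocks:
  "(\<Sum>i\<in>{1..n}. g \<bullet> bl i v) = g \<bullet> v"
  using sum_block[of "{1..n}" blk v] blocks by (simp flip: inner_sum_right)

text \<open>For a move in one block only, the lower bound from strong convexity and the averaged
  upper bound \<open>eso\<close> share their linear term, so the coefficients \<open>\<mu>\<close>
  and \<open>\<beta>\<close> of the same positive quadratic term are compared.\<close>

lemma strong_convexity_parameter_le:
  fixes f :: "real ^ 'm \<Rightarrow> real"
  assumes conv: "convex_on UNIV f" and diff: "\<And>y. f differentiable (at y)"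
    and strong: "strongly_convex_wrt (wnorm blk n nrm w) (\<lambda>y. ereal (f y)) \<mu>"
    and fin: "finite \<S>" "\<S> \<noteq> {}" "\<And>S. S \<in> \<S> \<Longrightarrow> S \<subseteq> {1..n}" and p: "0 < p"
    and marginal: "\<And>i. i \<in> {1..n} \<Longrightarrow> (\<Sum>S\<in>\<S>. of_bool (i \<in> S)) = real (card \<S>) * p"
    and eso: "\<And>y d. (\<And>i. i \<in> {1..n} \<Longrightarrow> d i \<in> block_space blk i) \<Longrightarrow>
        (\<Sum>S\<in>\<S>. f (y + (\<Sum>i\<in>S. d i)) - f y) \<le> real (card \<S>) * p *
          (\<Sum>i\<in>{1..n}. gradient f y \<bullet> d i + \<beta> / 2 * (w i * (nrm i (d i))\<^sup>2))"
  shows "\<mu> \<le> \<beta>"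
proof -
  \<comment> \<open>Any coordinate will do; its unit vector is a nonzero element of its block
    space.\<close>
  define k :: 'm where "k = undefined"
  define i0 where "i0 = blk k"
  define t :: "real ^ 'm" where "t = axis k 1"
  have i0: "i0 \<in> {1..n}"
    using blocks by (simp add: i0_def)
  have t: "t \<in> block_space blk i0" "t \<noteq> 0"
    by (auto simp: t_def i0_def block_space_def axis_def vec_eq_iff)
  have "0 \<le> nrm i0 t" "nrm i0 t \<noteq> 0"
    using norms[OF i0] t unfolding is_norm_on_def by auto
  then have N: "0 < w i0 * (nrm i0 t)\<^sup>2"
    using w_pos[OF i0] by simp
  define d where "d i = (if i = i0 then t else 0)" for i
  have d: "d i \<in> block_space blk i" for i
    using t subspace_0[OF subspace_block_space] by (auto simp: d_def)
  have nrm0: "nrm i 0 = 0" if "i \<in> {1..n}" for i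
    using norms[OF that] subspace_0[OF subspace_block_space] unfolding is_norm_on_def by blast
  have dS: "(\<Sum>i\<in>S. d i) = of_bool (i0 \<in> S) *\<^sub>R t" if "S \<in> \<S>" for S
  proof -
    have "finite S"
      using fin(3)[OF that] finite_subset by blast
    then show ?thesis
      by (simp add: d_def)
  qed
  have qt: "q t = w i0 * (nrm i0 t)\<^sup>2"
    using q_sum_block_space[OF d] i0 nrm0
    by (simp add: d_def if_distrib[of "\<lambda>v. (nrm _ v)\<^sup>2"] if_distrib[of "(*) _"] cong: if_cong)
  have "real (card \<S>) * p * (gradient f 0 \<bullet> t + \<mu> / 2 * q t) = (\<Sum>S\<in>\<S>. of_bool (i0 \<in> S) * (gradient f 0 \<bullet> t + \<mu> / 2 * q t))"
    using marginal[OF i0] by (simp add: sum_distrib_right[symmetric])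
  also have "\<dots> \<le> (\<Sum>S\<in>\<S>. f (0 + (\<Sum>i\<in>S. d i)) - f 0)"
    using gradient_strong_convexity[OF conv diff strong, of 0 t]
    by (intro sum_mono) (simp add: dS wnorm_power2)
  also have "\<dots> \<le> real (card \<S>) * p * (\<Sum>i\<in>{1..n}. gradient f 0 \<bullet> d i + \<beta> / 2 * (w i * (nrm i (d i))\<^sup>2))"
    using d by (rule eso)
  also have "(\<Sum>i\<in>{1..n}. gradient f 0 \<bullet> d i + \<beta> / 2 * (w i * (nrm i (d i))\<^sup>2)) = gradient f 0 \<bullet> t + \<beta> / 2 * q t"
    unfolding qt using i0 nrm0 by (subst sum.remove[of _ i0]) (auto simp: d_def intro!: sum.neutral)
  finally have "gradient f 0 \<bullet> t + \<mu> / 2 * q t \<le> gradient f 0 \<bullet> t + \<beta> / 2 * q t"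
    using p fin by (simp add: card_gt_0_iff)
  then have "\<mu> * q t \<le> \<beta> * q t"
    by simp
  then show ?thesis
    using N unfolding qt by (rule mult_right_le_imp_le)
qed

text \<open>The average is over the samples at a fixed point \<open>y\<close>. Both parts of the
  objective are controlled by the model of the full update, in which every block moves: the smooth
  part through \<open>eso\<close>, the regularizer exactly.\<close>

lemma expected_decrease:
  fixes f :: "real ^ 'm \<Rightarrow> real" and h :: "nat \<Rightarrow> real ^ 'm"
  assumes conv: "convex_on UNIV f" and diff: "\<And>y. f differentiable (at y)"
    and f_strong: "strongly_convex_wrt (wnorm blk n nrm w) (\<lambda>y. ereal (f y)) \<mu>f"
    and O_strong: "strongly_convex_wrt (wnorm blk n nrm w) (block_separable blk n \<Omega>) \<mu>O"
    and mu: "0 < \<mu>f + \<mu>O" "\<mu>f \<le> \<beta>"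
    and fin: "finite \<S>" "\<And>S. S \<in> \<S> \<Longrightarrow> S \<subseteq> {1..n}" and p: "0 \<le> p"
    and marginal: "\<And>i. i \<in> {1..n} \<Longrightarrow> (\<Sum>S\<in>\<S>. of_bool (i \<in> S)) = real (card \<S>) * p"
    and y: "y \<in> feasible" and xs: "xs \<in> feasible"
    and h: "\<And>i. i \<in> {1..n} \<Longrightarrow> is_block_update blk nrm f \<Omega> \<beta> w i y (h i)"
    and eso: "(\<Sum>S\<in>\<S>. f (y + (\<Sum>i\<in>S. h i)) - f y) \<le> real (card \<S>) * p *
          (\<Sum>i\<in>{1..n}. gradient f y \<bullet> h i + \<beta> / 2 * (w i * (nrm i (h i))\<^sup>2))"
  defines "Fr \<equiv> \<lambda>y. f y + R y"
  shows "\<And>S. S \<subseteq> {1..n} \<Longrightarrow> y + (\<Sum>i\<in>S. h i) \<in> feasible"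
    and "(\<Sum>S\<in>\<S>. Fr (y + (\<Sum>i\<in>S. h i)) - Fr xs) \<le>
      real (card \<S>) * (1 - p * ((\<mu>f + \<mu>O) / (\<beta> + \<mu>O))) * (Fr y - Fr xs)"
proof -
  have h_space: "h i \<in> block_space blk i" if "i \<in> {1..n}" for i
    using h[OF that] by (simp add: is_block_update_def is_arg_min_def)
  have yi: "\<Omega> i (bl i y) = ereal (\<omega> i (bl i y))" if "i \<in> {1..n}" for i
    using y that by (intro Omega_real block_in_block_space) (auto simp: feasible_def)
  have h_le: "ereal (bl i (gradient f y) \<bullet> h i + \<beta> * w i / 2 * (nrm i (h i))\<^sup>2) + \<Omega> i (bl i y + h i) \<le>
      ereal (bl i (gradient f y) \<bullet> t + \<beta> * w i / 2 * (nrm i t)\<^sup>2) + \<Omega> i (bl i y + t)"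
    if "i \<in> {1..n}" "t \<in> block_space blk i" for i t
    using h[OF that(1)] that(2) unfolding is_block_update_def is_arg_min_linorder by blast
  have add_space: "bl i y + t \<in> block_space blk i" if "t \<in> block_space blk i" for i t
    using that subspace_add[OF subspace_block_space block_in_block_space] by blast
  \<comment> \<open>The zero step has a finite model value, so a minimizer cannot leave the
    domain.\<close>
  have h_dom: "\<Omega> i (bl i y + h i) < \<infinity>" if i: "i \<in> {1..n}" for i
  proof (rule ccontr)
    assume "\<not> \<Omega> i (bl i y + h i) < \<infinity>"
    then have "\<infinity> \<le> ereal (bl i (gradient f y) \<bullet> 0 + \<beta> * w i / 2 * (nrm i 0)\<^sup>2) + \<Omega> i (bl i y + 0)"
      using h_le[OF i subspace_0[OF subspace_block_space]] by simp
    then show False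
      using yi[OF i] by simp
  qed
  have hi: "\<Omega> i (bl i y + h i) = ereal (\<omega> i (bl i y + h i))" if "i \<in> {1..n}" for i
    using that h_dom h_space by (intro Omega_real add_space) auto
  have bl_next: "bl i (y + (\<Sum>j\<in>S. h j)) = (if i \<in> S then bl i y + h i else bl i y)" if "S \<subseteq> {1..n}" for i S
    using that h_space finite_subset[OF that] by (subst block_add, subst block_sum_block_space) auto
  show "y + (\<Sum>i\<in>S. h i) \<in> feasible" if "S \<subseteq> {1..n}" for S
    using that h_dom y by (simp add: feasible_def bl_next)
  define \<alpha> where "\<alpha> = (\<mu>f + \<mu>O) / (\<beta> + \<mu>O)"
  \<comment> \<open>Both the positive denominator and \<open>\<alpha> \<le> 1\<close> come from
    \<open>\<mu>f \<le> \<beta>\<close>.\<close>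
  have \<alpha>: "0 \<le> \<alpha>" "\<alpha> \<le> 1" and \<alpha>_eq: "\<alpha> * (\<beta> + \<mu>O) = \<mu>f + \<mu>O"
    using mu by (auto simp: \<alpha>_def field_simps)
  define z where "z = \<alpha> *\<^sub>R xs + (1 - \<alpha>) *\<^sub>R y"
  have z: "z \<in> feasible"
    unfolding z_def using xs y \<alpha> by (rule convex_combination_in_dom)
  let ?D = "q (xs - y)"
  have "z - y = \<alpha> *\<^sub>R (xs - y)"
    by (simp add: z_def algebra_simps)
  then have qzy: "q (z - y) = \<alpha>\<^sup>2 * ?D"
    by (simp add: q_scaleR)
  let ?g = "gradient f y"
  have "(\<Sum>i\<in>{1..n}. ?g \<bullet> h i + \<beta> / 2 * (w i * (nrm i (h i))\<^sup>2) + \<omega> i (bl i y + h i)) \<le>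
      (\<Sum>i\<in>{1..n}. ?g \<bullet> bl i (z - y) + \<beta> / 2 * (w i * (nrm i (bl i (z - y)))\<^sup>2) + \<omega> i (bl i z))"
  proof (rule sum_mono)
    fix i assume i: "i \<in> {1..n}"
    have "bl i y + bl i (z - y) = bl i z"
      by (simp add: block_diff)
    moreover have "\<Omega> i (bl i z) = ereal (\<omega> i (bl i z))"
      using z i by (intro Omega_real block_in_block_space) (auto simp: feasible_def)
    ultimately show "?g \<bullet> h i + \<beta> / 2 * (w i * (nrm i (h i))\<^sup>2) + \<omega> i (bl i y + h i) \<le>
        ?g \<bullet> bl i (z - y) + \<beta> / 2 * (w i * (nrm i (bl i (z - y)))\<^sup>2) + \<omega> i (bl i z)"
      using h_le[OF i block_in_block_space, of "z - y"] hi[OF i]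
        inner_block[OF h_space[OF i], of ?g] inner_block[OF block_in_block_space, of blk i ?g "z - y"]
      by (simp add: mult.assoc)
  qed
  also have "\<dots> = ?g \<bullet> (z - y) + \<beta> / 2 * q (z - y) + R z"
    by (simp only: sum.distrib inner_sum_blocks q_def R_def sum_distrib_left)
  finally have model: "(\<Sum>i\<in>{1..n}. ?g \<bullet> h i + \<beta> / 2 * (w i * (nrm i (h i))\<^sup>2)) + (\<Sum>i\<in>{1..n}. \<omega> i (bl i y + h i))
      \<le> ?g \<bullet> (z - y) + \<beta> / 2 * q (z - y) + R z"
    by (simp add: sum.distrib)
  \<comment> \<open>Trading the linear model for \<open>f z\<close> also returns part of the
    curvature \<open>\<beta>\<close> spent at \<open>z\<close>.\<close>
  have "f y + ?g \<bullet> (z - y) + \<mu>f / 2 * q (z - y) \<le> f z"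
    using gradient_strong_convexity[OF conv diff f_strong, of y z] by (simp add: wnorm_power2)
  moreover have "f z \<le> \<alpha> * f xs + (1 - \<alpha>) * f y - \<mu>f / 2 * (\<alpha> * (1 - \<alpha>) * ?D)"
  proof -
    let ?gz = "gradient f z"
    have "\<alpha> * (?gz \<bullet> (xs - z)) + (1 - \<alpha>) * (?gz \<bullet> (y - z)) = ?gz \<bullet> (\<alpha> *\<^sub>R (xs - z) + (1 - \<alpha>) *\<^sub>R (y - z))"
      by (simp add: inner_add_right)
    also have "\<alpha> *\<^sub>R (xs - z) + (1 - \<alpha>) *\<^sub>R (y - z) = 0"
      by (simp add: z_def algebra_simps)
    finally have "f z + \<mu>f / 2 * (\<alpha> * q (xs - z) + (1 - \<alpha>) * q (y - z)) =
        \<alpha> * (f z + ?gz \<bullet> (xs - z) + \<mu>f / 2 * q (xs - z)) + (1 - \<alpha>) * (f z + ?gz \<bullet> (y - z) + \<mu>f / 2 * q (y - z))"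
      by (simp add: field_simps)
    also have "\<dots> \<le> \<alpha> * f xs + (1 - \<alpha>) * f y"
      using gradient_strong_convexity[OF conv diff f_strong, of z] \<alpha>
      by (intro add_mono mult_left_mono) (auto simp: wnorm_power2)
    finally have "f z + \<mu>f / 2 * (\<alpha> * q (xs - z) + (1 - \<alpha>) * q (y - z)) \<le> \<alpha> * f xs + (1 - \<alpha>) * f y" .
    moreover have "\<mu>f / 2 * (\<alpha> * (1 - \<alpha>) * ?D) \<le> \<mu>f / 2 * (\<alpha> * q (xs - z) + (1 - \<alpha>) * q (y - z))"
      using f_strong q_interpolate[OF \<alpha>] by (intro mult_left_mono) (auto simp: strongly_convex_wrt_def)
    ultimately show ?thesis
      by linarith
  qed
  moreover have "R z \<le> \<alpha> * R xs + (1 - \<alpha>) * R y - \<mu>O / 2 * (\<alpha> * (1 - \<alpha>) * ?D)"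
    unfolding z_def using O_strong xs y \<alpha> by (rule separable_strong_convexity)
  \<comment> \<open>The equation that determines \<open>\<alpha>\<close>: the remaining curvature
    \<open>\<beta> - \<mu>f\<close> at \<open>z\<close> is exactly paid for by the strong convexity
    gains of \<open>f\<close> and of the regularizer along the segment.\<close>
  moreover have "\<beta> / 2 * q (z - y) - \<mu>f / 2 * q (z - y) =
      \<mu>f / 2 * (\<alpha> * (1 - \<alpha>) * ?D) + \<mu>O / 2 * (\<alpha> * (1 - \<alpha>) * ?D)"
  proof -
    have "\<beta> * \<alpha> - \<mu>f * \<alpha> = (\<mu>f + \<mu>O) * (1 - \<alpha>)"
      using \<alpha>_eq by (simp add: algebra_simps)
    then have "(\<beta> * \<alpha> - \<mu>f * \<alpha>) * (\<alpha> * ?D / 2) = (\<mu>f + \<mu>O) * (1 - \<alpha>) * (\<alpha> * ?D / 2)"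
      by simp
    then show ?thesis
      unfolding qzy by (simp add: field_simps power2_eq_square)
  qed
  ultimately have H: "f y + (\<Sum>i\<in>{1..n}. ?g \<bullet> h i + \<beta> / 2 * (w i * (nrm i (h i))\<^sup>2)) + (\<Sum>i\<in>{1..n}. \<omega> i (bl i y + h i))
      \<le> \<alpha> * Fr xs + (1 - \<alpha>) * Fr y"
    using model unfolding Fr_def distrib_left by linarith
  \<comment> \<open>An identity, not an estimate: \<open>R\<close> is a sum over blocks, and each
    block is replaced with the same frequency.\<close>
  have R_sum: "(\<Sum>S\<in>\<S>. R (y + (\<Sum>i\<in>S. h i)) - R y) =
      real (card \<S>) * p * ((\<Sum>i\<in>{1..n}. \<omega> i (bl i y + h i)) - R y)"
  proof -
    have "(\<Sum>S\<in>\<S>. R (y + (\<Sum>i\<in>S. h i)) - R y) =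
        (\<Sum>S\<in>\<S>. \<Sum>i\<in>{1..n}. of_bool (i \<in> S) * (\<omega> i (bl i y + h i) - \<omega> i (bl i y)))"
      unfolding R_def sum_subtractf[symmetric]
      by (intro sum.cong refl) (use fin in \<open>auto simp: bl_next\<close>)
    also have "\<dots> = (\<Sum>i\<in>{1..n}. real (card \<S>) * p * (\<omega> i (bl i y + h i) - \<omega> i (bl i y)))"
      by (subst sum.swap) (simp add: marginal flip: sum_distrib_right)
    finally show ?thesis
      by (simp add: R_def sum_subtractf flip: sum_distrib_left)
  qed
  have "(\<Sum>S\<in>\<S>. Fr (y + (\<Sum>i\<in>S. h i)) - Fr xs) =
      (\<Sum>S\<in>\<S>. f (y + (\<Sum>i\<in>S. h i)) - f y) + (\<Sum>S\<in>\<S>. R (y + (\<Sum>i\<in>S. h i)) - R y)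
      + real (card \<S>) * (Fr y - Fr xs)"
    by (simp add: Fr_def sum_subtractf sum.distrib algebra_simps)
  also have "\<dots> \<le> real (card \<S>) * p *
        ((\<Sum>i\<in>{1..n}. ?g \<bullet> h i + \<beta> / 2 * (w i * (nrm i (h i))\<^sup>2)) + (\<Sum>i\<in>{1..n}. \<omega> i (bl i y + h i)) - R y)
      + real (card \<S>) * (Fr y - Fr xs)"
    using eso unfolding R_sum by (simp add: algebra_simps)
  also have "\<dots> \<le> real (card \<S>) * p * (\<alpha> * Fr xs + (1 - \<alpha>) * Fr y - Fr y) + real (card \<S>) * (Fr y - Fr xs)"
    using H p by (intro add_mono mult_left_mono order_refl) (auto simp: Fr_def)
  also have "\<dots> = real (card \<S>) * (1 - p * \<alpha>) * (Fr y - Fr xs)"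
    by (simp add: algebra_simps)
  finally show "(\<Sum>S\<in>\<S>. Fr (y + (\<Sum>i\<in>S. h i)) - Fr xs) \<le>
      real (card \<S>) * (1 - p * ((\<mu>f + \<mu>O) / (\<beta> + \<mu>O))) * (Fr y - Fr xs)"
    unfolding \<alpha>_def .
qed

end

section \<open>Contraction in expectation along independent samples\<close>

text \<open>The iterate as a deterministic function of the sample path \<open>z\<close>. It reads
  only the entries before \<open>k\<close>, which is the source of its independence from sample
  \<open>k\<close>.\<close>

primrec recursive_iterate :: "('v \<Rightarrow> 's \<Rightarrow> 'v) \<Rightarrow> 'v \<Rightarrow> (nat \<Rightarrow> 's) \<Rightarrow> nat \<Rightarrow> 'v" where
  "recursive_iterate G x0 z 0 = x0"
| "recursive_iterate G x0 z (Suc k) = G (recursive_iterate G x0 z k) (z k)"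

lemma recursive_iterate_cong:
  "(\<And>i. i < k \<Longrightarrow> z i = z' i) \<Longrightarrow> recursive_iterate G x0 z k = recursive_iterate G x0 z' k"
  by (induction k) auto

text \<open>\<open>G\<close> and \<open>\<Phi>\<close> are arbitrary functions. The first
  \<open>k\<close> samples take values in a finite set with the discrete sigma-algebra, so any
  function of them is measurable and bounded. The inequality \<open>step\<close> is asked only at
  visited points, where the updates are known to be minimizers.\<close>

lemma (in prob_space) indep_iterates_contraction:
  fixes Z :: "nat \<Rightarrow> 'a \<Rightarrow> 's" and x :: "nat \<Rightarrow> 'a \<Rightarrow> 'v" and \<Phi> :: "'v \<Rightarrow> real"
  assumes finU: "finite \<U>" and SU: "\<S> \<subseteq> \<U>" "\<S> \<noteq> {}"
    and Z_range: "\<And>k \<omega>. \<omega> \<in> space M \<Longrightarrow> Z k \<omega> \<in> \<U>"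
    and indep: "indep_vars (\<lambda>_. count_space UNIV) Z UNIV"
    and law: "\<And>k. distr M (count_space UNIV) (Z k) = measure_pmf (pmf_of_set \<S>)"
    and x_0: "\<And>\<omega>. \<omega> \<in> space M \<Longrightarrow> x 0 \<omega> = x0"
    and x_Suc: "\<And>k \<omega>. \<omega> \<in> space M \<Longrightarrow> x (Suc k) \<omega> = G (x k \<omega>) (Z k \<omega>)"
    and step: "\<And>k \<omega>. \<omega> \<in> space M \<Longrightarrow> (\<Sum>S\<in>\<S>. \<Phi> (G (x k \<omega>) S)) \<le> real (card \<S>) * c * \<Phi> (x k \<omega>)"
    and c: "0 \<le> c"
  shows "integrable M (\<lambda>\<omega>. \<Phi> (x k \<omega>)) \<and> (\<integral>\<omega>. \<Phi> (x k \<omega>) \<partial>M) \<le> c ^ k * \<Phi> x0"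
proof -
  have finS: "finite \<S>"
    using SU finU finite_subset by blast
  then have cardS: "0 < real (card \<S>)"
    using SU by (simp add: card_gt_0_iff)
  obtain S0 where S0: "S0 \<in> \<U>"
    using SU by auto
  \<comment> \<open>Outside the sample space \<open>Z\<close> may take any value. Retracting to the
    finite set \<open>\<U>\<close> changes nothing on the sample space, preserves independence, and
    makes finite products discrete.\<close>
  define r where "r S = (if S \<in> \<U> then S else S0)" for S
  define Z' where "Z' k \<omega> = r (Z k \<omega>)" for k \<omega>
  have Z': "Z' k \<omega> = Z k \<omega>" if "\<omega> \<in> space M" for k \<omega>
    using Z_range[OF that] by (simp add: Z'_def r_def)
  have indep': "indep_vars (\<lambda>_. count_space \<U>) Z' UNIV"
    unfolding Z'_def using S0 by (intro indep_vars_compose2[OF indep]) (auto simp: r_def)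
  have PiM_eq: "PiM A (\<lambda>_. count_space \<U>) = count_space (A \<rightarrow>\<^sub>E \<U>)" if "finite A" for A :: "nat set"
    using that finU by (intro count_space_PiM_finite) (auto intro: countable_finite)
  define Y where "Y k \<omega> = restrict (\<lambda>i. Z' i \<omega>) {..<k}" for k \<omega>
  let ?W = "\<lambda>k::nat. {..<k} \<rightarrow>\<^sub>E \<U>"
  have Z'_meas: "Z' k \<in> measurable M (count_space \<U>)" for k
    using indep' by (simp add: indep_vars_def2)
  have Y_meas: "Y k \<in> measurable M (count_space (?W k))" for k
    unfolding Y_def PiM_eq[OF finite_lessThan, symmetric] by (intro measurable_restrict Z'_meas)
  have finW: "finite (?W k)" for k
    using finU by (intro finite_PiE) auto
  have Y_int: "integrable M (\<lambda>\<omega>. g (Y k \<omega>))" for g :: "(nat \<Rightarrow> 's) \<Rightarrow> real" and k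
  proof (rule integrable_const_bound)
    show "AE \<omega> in M. norm (g (Y k \<omega>)) \<le> (\<Sum>z\<in>?W k. \<bar>g z\<bar>)"
    proof (rule AE_I2)
      fix \<omega> assume "\<omega> \<in> space M"
      then have "Y k \<omega> \<in> ?W k"
        using Y_meas[of k] by (auto simp: measurable_count_space_eq2[OF finW])
      then show "norm (g (Y k \<omega>)) \<le> (\<Sum>z\<in>?W k. \<bar>g z\<bar>)"
        using finW member_le_sum[of "Y k \<omega>" "?W k" "\<lambda>z. \<bar>g z\<bar>"] by simp
    qed
    show "(\<lambda>\<omega>. g (Y k \<omega>)) \<in> borel_measurable M"
      using Y_meas by (rule measurable_compose) simp
  qed
  let ?X = "\<lambda>k z. recursive_iterate G x0 z k"
  have x_eq: "x k \<omega> = ?X k (Y k \<omega>)" if \<omega>: "\<omega> \<in> space M" for k \<omega>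
  proof -
    have "x k \<omega> = ?X k (\<lambda>i. Z' i \<omega>)"
      using \<omega> by (induction k) (simp_all add: x_0 x_Suc Z')
    also have "\<dots> = ?X k (Y k \<omega>)"
      by (rule recursive_iterate_cong) (simp add: Y_def)
    finally show ?thesis .
  qed
  have int: "integrable M (\<lambda>\<omega>. g (x k \<omega>))" for g :: "'v \<Rightarrow> real" and k
    using Y_int[of "\<lambda>z. g (?X k z)" k] by (simp add: x_eq cong: Bochner_Integration.integrable_cong)
  have Z_int: "integrable M (\<lambda>\<omega>. of_bool (Z' k \<omega> = S) :: real)" for k S
    using Y_int[of "\<lambda>z. of_bool (z k = S)" "Suc k"] by (simp add: Y_def)
  have prob: "(\<integral>\<omega>. of_bool (Z' k \<omega> = S) \<partial>M) = of_bool (S \<in> \<S>) / real (card \<S>)" for k S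
  proof -
    have Z_meas: "Z k \<in> measurable M (count_space UNIV)"
      using indep by (simp add: indep_vars_def2)
    have "(\<integral>\<omega>. of_bool (Z' k \<omega> = S) \<partial>M) = (\<integral>\<omega>. of_bool (Z k \<omega> = S) \<partial>M :: real)"
      by (intro Bochner_Integration.integral_cong) (simp_all add: Z')
    also have "\<dots> = (\<integral>T. of_bool (T = S) \<partial>distr M (count_space UNIV) (Z k))"
      using Z_meas by (subst integral_distr) auto
    also have "\<dots> = (\<Sum>T\<in>\<S>. of_bool (T = S)) / real (card \<S>)"
      unfolding law using SU finS by (simp add: integral_pmf_of_set)
    also have "(\<Sum>T\<in>\<S>. of_bool (T = S) :: real) = of_bool (S \<in> \<S>)"
      using finS by (simp add: of_bool_def)
    finally show ?thesis .
  qed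
  have product: "(\<integral>\<omega>. of_bool (Z' k \<omega> = S) * g (x k \<omega>) \<partial>M) = of_bool (S \<in> \<S>) / real (card \<S>) * (\<integral>\<omega>. g (x k \<omega>) \<partial>M) \<and>
      integrable M (\<lambda>\<omega>. of_bool (Z' k \<omega> = S) * g (x k \<omega>))"
    for k S and g :: "'v \<Rightarrow> real"
  proof -
    \<comment> \<open>The index sets \<open>{k}\<close> and \<open>{..<k}\<close> are disjoint, so
      the current sample is independent of the history.\<close>
    have "indep_var (PiM {k} (\<lambda>_. count_space \<U>)) (\<lambda>\<omega>. restrict (\<lambda>i. Z' i \<omega>) {k})
        (PiM {..<k} (\<lambda>_. count_space \<U>)) (Y k)"
      unfolding Y_def by (rule indep_var_restrict[OF indep']) auto
    then have "indep_var borel ((\<lambda>z. of_bool (z k = S) :: real) \<circ> (\<lambda>\<omega>. restrict (\<lambda>i. Z' i \<omega>) {k}))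
        borel ((\<lambda>z. g (?X k z)) \<circ> Y k)"
      by (rule indep_var_compose) (simp_all add: PiM_eq)
    then have ind: "indep_var borel (\<lambda>\<omega>. of_bool (Z' k \<omega> = S) :: real) borel (\<lambda>\<omega>. g (?X k (Y k \<omega>)))"
      by (simp add: o_def)
    note facts = ind Z_int[of k S] Y_int[of "\<lambda>z. g (?X k z)" k]
    have "(\<integral>\<omega>. of_bool (Z' k \<omega> = S) * g (?X k (Y k \<omega>)) \<partial>M) =
        (\<integral>\<omega>. of_bool (Z' k \<omega> = S) \<partial>M) * (\<integral>\<omega>. g (?X k (Y k \<omega>)) \<partial>M)"
      by (rule indep_var_lebesgue_integral[OF facts])
    moreover have "integrable M (\<lambda>\<omega>. of_bool (Z' k \<omega> = S) * g (?X k (Y k \<omega>)))"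
      by (rule indep_var_integrable[OF facts])
    ultimately show ?thesis
      by (simp add: x_eq prob cong: Bochner_Integration.integrable_cong Bochner_Integration.integral_cong)
  qed
  have "(\<integral>\<omega>. \<Phi> (x k \<omega>) \<partial>M) \<le> c ^ k * \<Phi> x0"
  proof (induction k)
    case 0
    have "(\<integral>\<omega>. \<Phi> (x 0 \<omega>) \<partial>M) = (\<integral>\<omega>. \<Phi> x0 \<partial>M)"
      by (intro Bochner_Integration.integral_cong) (simp_all add: x_0)
    then show ?case
      by (simp add: prob_space)
  next
    case (Suc k)
    \<comment> \<open>Splitting by the value of the current sample turns each term into a product of
      independent factors.\<close>
    have "(\<integral>\<omega>. \<Phi> (x (Suc k) \<omega>) \<partial>M) = (\<integral>\<omega>. (\<Sum>S\<in>\<U>. of_bool (Z' k \<omega> = S) * \<Phi> (G (x k \<omega>) S)) \<partial>M)"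
    proof (rule Bochner_Integration.integral_cong[OF refl])
      fix \<omega> assume \<omega>: "\<omega> \<in> space M"
      have "(\<Sum>S\<in>\<U>. of_bool (Z' k \<omega> = S) * \<Phi> (G (x k \<omega>) S)) = (\<Sum>S\<in>\<U>. if Z k \<omega> = S then \<Phi> (G (x k \<omega>) S) else 0)"
        using \<omega> by (intro sum.cong) (auto simp: Z')
      then show "\<Phi> (x (Suc k) \<omega>) = (\<Sum>S\<in>\<U>. of_bool (Z' k \<omega> = S) * \<Phi> (G (x k \<omega>) S))"
        using Z_range[OF \<omega>] finU by (simp add: x_Suc[OF \<omega>])
    qed
    also have "\<dots> = (\<Sum>S\<in>\<U>. of_bool (S \<in> \<S>) / real (card \<S>) * (\<integral>\<omega>. \<Phi> (G (x k \<omega>) S) \<partial>M))"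
      using product[of k _ "\<lambda>v. \<Phi> (G v _)"] by (subst Bochner_Integration.integral_sum) auto
    \<comment> \<open>Values in \<open>\<U>\<close> outside \<open>\<S>\<close> can be attained, but
      only with probability 0.\<close>
    also have "\<dots> = (\<Sum>S\<in>\<S>. (\<integral>\<omega>. \<Phi> (G (x k \<omega>) S) \<partial>M) / real (card \<S>))"
      using SU finU by (intro sum.mono_neutral_cong_right) auto
    also have "\<dots> = (\<integral>\<omega>. (\<Sum>S\<in>\<S>. \<Phi> (G (x k \<omega>) S)) \<partial>M) / real (card \<S>)"
      using int[of "\<lambda>v. \<Phi> (G v _)"] by (subst Bochner_Integration.integral_sum) (auto simp: sum_divide_distrib)
    also have "\<dots> \<le> (\<integral>\<omega>. real (card \<S>) * c * \<Phi> (x k \<omega>) \<partial>M) / real (card \<S>)"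
      using step cardS int[of "\<lambda>v. \<Sum>S\<in>\<S>. \<Phi> (G v S)" k] int[of \<Phi> k]
      by (intro divide_right_mono integral_mono) auto
    also have "\<dots> = c * (\<integral>\<omega>. \<Phi> (x k \<omega>) \<partial>M)"
      using cardS by simp
    also have "\<dots> \<le> c * (c ^ k * \<Phi> x0)"
      using Suc.IH c by (rule mult_left_mono)
    finally show ?case
      by (simp add: mult.assoc)
  qed
  then show ?thesis
    using int by blast
qed

section \<open>Partially separable functions\<close>

lemma convex_on_sum_functions:
  assumes "finite A" "\<And>i. i \<in> A \<Longrightarrow> convex_on UNIV (g i)"
  shows "convex_on UNIV (\<lambda>y. \<Sum>i\<in>A. g i y)"
  using assms by (induction A) (auto simp: convex_on_const)

text \<open>Pairing a difference of gradients with \<open>t\<close> sees only block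
  \<open>i\<close>, where the conjugate norm bound applies.\<close>

lemma block_smooth:
  fixes f :: "real ^ 'm::finite \<Rightarrow> real"
  assumes diff: "\<And>y. f differentiable (at y)" and nrm: "is_norm_on (block_space blk i) nrm"
    and lip: "\<And>y t. t \<in> block_space blk i \<Longrightarrow>
          conj_norm (block_space blk i) nrm (block blk i (gradient f (y + t)) - block blk i (gradient f y)) \<le> L * nrm t"
    and t: "t \<in> block_space blk i"
  shows "f (y + t) \<le> f y + gradient f y \<bullet> t + L / 2 * (nrm t)\<^sup>2"
proof -
  have "(gradient f (y + r *\<^sub>R t) - gradient f y) \<bullet> t \<le> r * (L * (nrm t)\<^sup>2)" if r: "0 \<le> r" for r
  proof -
    have rt: "r *\<^sub>R t \<in> block_space blk i"
      using t by (rule subspace_scale[OF subspace_block_space])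
    have "(gradient f (y + r *\<^sub>R t) - gradient f y) \<bullet> t =
        (block blk i (gradient f (y + r *\<^sub>R t)) - block blk i (gradient f y)) \<bullet> t"
      using t by (simp add: inner_diff_left inner_block)
    also have "\<dots> \<le> conj_norm (block_space blk i) nrm
        (block blk i (gradient f (y + r *\<^sub>R t)) - block blk i (gradient f y)) * nrm t"
      using subspace_block_space nrm t by (rule inner_le_conj_norm)
    also have "\<dots> \<le> (L * nrm (r *\<^sub>R t)) * nrm t"
      using lip[OF rt] nrm t by (intro mult_right_mono) (auto simp: is_norm_on_def)
    also have "nrm (r *\<^sub>R t) = r * nrm t"
      using nrm t r by (simp add: is_norm_on_def)
    finally show ?thesis
      by (simp add: power2_eq_square algebra_simps)
  qed
  then show ?thesis
    using lipschitz_gradient_upper_bound[OF diff, of y t "L * (nrm t)\<^sup>2"] by simp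
qed

text \<open>The increments of the \<open>fJ J\<close> at \<open>y\<close> satisfy the abstract
  hypotheses: \<open>fJ J\<close> ignores all blocks outside \<open>J\<close>, hence all those
  outside the larger set \<open>T J\<close>.\<close>

lemma partially_separable_overapproximation:
  fixes f :: "real ^ 'm::finite \<Rightarrow> real" and \<xi> :: nat
  assumes sampling: "partition_sampling C s \<tau> P" and V_eq: "partition_sampling.V C P = {1..n}"
    and J_subsets: "\<J> \<subseteq> Pow {1..n}" "\<J> \<noteq> {}"
    and f_sum: "\<And>y. f y = (\<Sum>J\<in>\<J>. fJ J y)"
    and fJ_convex: "\<And>J. J \<in> \<J> \<Longrightarrow> convex_on UNIV (fJ J)"
    and fJ_blocks: "\<And>J y z. J \<in> \<J> \<Longrightarrow> (\<And>i. i \<in> J \<Longrightarrow> block blk i y = block blk i z) \<Longrightarrow> fJ J y = fJ J z"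
    and diff: "\<And>y. f differentiable (at y)"
    and smooth: "\<And>i r. i \<in> {1..n} \<Longrightarrow> f (y + r *\<^sub>R d i) \<le> f y + r * (gradient f y \<bullet> d i) + r\<^sup>2 * b i"
    and b_nonneg: "\<And>i. i \<in> {1..n} \<Longrightarrow> 0 \<le> b i"
    and d: "\<And>i. i \<in> {1..n} \<Longrightarrow> d i \<in> block_space blk i"
    and xi: "\<And>c J. c \<in> {1..C} \<Longrightarrow> J \<in> \<J> \<Longrightarrow> card (P c \<inter> J) \<le> \<xi>" "\<xi> \<le> s"
    and beta: "\<beta> = 1 + (real \<xi> - 1) * (real \<tau> - 1) / max 1 (real s - 1)
                        + (real C - 1) * (real \<xi> * real \<tau> / real s)"
  shows "(\<Sum>S\<in>partition_sampling.samples C \<tau> P. f (y + (\<Sum>i\<in>S. d i)) - f y) \<le>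
    real (card (partition_sampling.samples C \<tau> P)) * (real \<tau> / real s) *
      (\<Sum>i\<in>{1..n}. gradient f y \<bullet> d i + \<beta> * b i)"
proof -
  interpret partition_sampling C s \<tau> P
    by (fact sampling)
  have finJ: "finite \<J>"
    using J_subsets(1) by (rule finite_subset) simp
  have JV: "J \<subseteq> V" if "J \<in> \<J>" for J
    using that J_subsets V_eq by auto
  show ?thesis
  proof (cases "\<xi> = 0")
    \<comment> \<open>For \<open>\<xi> = 0\<close> the enlarged sets are empty and offer no
      reference element. Every \<open>J\<close> is then empty and \<open>f\<close> is constant, so
      both sides reduce to \<open>0 \<le> \<beta>\<close> times a nonnegative sum;
      \<open>\<tau> \<le> s\<close> gives the sign of \<open>\<beta>\<close>.\<close>
    case True
    have "J = {}" if J: "J \<in> \<J>" for J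
    proof -
      have "P c \<inter> J = {}" if c: "c \<in> {1..C}" for c
        using xi(1)[OF c J] True fin_P[OF c] by simp
      then show ?thesis
        using JV[OF J] unfolding V_def by blast
    qed
    then have const: "f z = f y" for z
      unfolding f_sum by (intro sum.cong refl fJ_blocks) auto
    have "GDERIV f y :> 0"
    proof -
      have "f = (\<lambda>_. f y)"
        using const by auto
      then show ?thesis
        using GDERIV_const[of "f y" y] by simp
    qed
    then have "f y + gradient f y \<bullet> (y + gradient f y - y) \<le> f (y + gradient f y)"
      using convex_on_above_tangent[OF _ GDERIV_gradient[OF diff]] const
      by (metis convex_on_const convex_UNIV ext)
    then have "\<not> 0 < gradient f y \<bullet> gradient f y"
      using const[of "y + gradient f y"] unfolding add_diff_cancel_left' by linarith
    then have grad: "gradient f y = 0"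
      by (simp only: inner_gt_zero_iff not_not)
    have "real \<tau> - 1 \<le> max 1 (real s - 1)"
      using tau_le by auto
    then have "0 \<le> \<beta>"
      using True by (simp add: beta field_simps)
    then have "0 \<le> (\<Sum>i\<in>{1..n}. \<beta> * b i)"
      using b_nonneg by (intro sum_nonneg mult_nonneg_nonneg)
    moreover have "(\<Sum>S\<in>samples. f (y + (\<Sum>i\<in>S. d i)) - f y) = 0"
      by (intro sum.neutral) (metis const diff_self)
    ultimately show ?thesis
      by (simp add: grad)
  next
    case False
    have "\<exists>T. J \<subseteq> T \<and> balanced_set \<xi> T" if "J \<in> \<J>" for J
      using balanced_set_extend[OF JV[OF that] xi(1)[OF _ that] xi(2)] by metis
    then obtain T where T: "\<And>J. J \<in> \<J> \<Longrightarrow> J \<subseteq> T J \<and> balanced_set \<xi> (T J)"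
      by metis
    define \<psi> where "\<psi> J u = fJ J (y + u) - fJ J y" for J u
    have sum_\<psi>: "(\<Sum>J\<in>\<J>. \<psi> J u) = f (y + u) - f y" for u
      by (simp add: \<psi>_def f_sum sum_subtractf)
    have "(\<Sum>S\<in>samples. \<Sum>J\<in>\<J>. \<psi> J (\<Sum>i\<in>S. d i))
        \<le> real (card samples) * (real \<tau> / real s) * (\<Sum>i\<in>V. gradient f y \<bullet> d i + \<beta> * b i)"
      unfolding beta
    proof (rule expected_separable_overapproximation[where T = T])
      show "\<J> \<noteq> {}" "0 < \<xi>"
        using J_subsets False by auto
      show "balanced_set \<xi> (T J)" if "J \<in> \<J>" for J
        using T[OF that] by blast
      show "convex_on UNIV (\<psi> J)" if J: "J \<in> \<J>" for J
      proof (rule convex_onI)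
        fix t :: real and u v :: "real ^ 'm" assume t: "0 < t" "t < 1"
        have "y + ((1 - t) *\<^sub>R u + t *\<^sub>R v) = (1 - t) *\<^sub>R (y + u) + t *\<^sub>R (y + v)"
          by (simp add: algebra_simps)
        then show "\<psi> J ((1 - t) *\<^sub>R u + t *\<^sub>R v) \<le> (1 - t) * \<psi> J u + t * \<psi> J v"
          using convex_onD[OF fJ_convex[OF J], of t "y + u" "y + v"] t by (simp add: \<psi>_def algebra_simps)
      qed simp
      show "\<psi> J 0 = 0" for J
        by (simp add: \<psi>_def)
      show "\<psi> J (r *\<^sub>R d i) = 0" if J: "J \<in> \<J>" and i: "i \<in> V" "i \<notin> T J" for J i r
      proof -
        have "fJ J (y + r *\<^sub>R d i) = fJ J y"
        proof (rule fJ_blocks[OF J])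
          fix k assume "k \<in> J"
          then have "k \<noteq> i"
            using T[OF J] i by auto
          then show "block blk k (y + r *\<^sub>R d i) = block blk k y"
            using block_block_space[OF d[of i], of k] i V_eq by (simp add: block_add block_scaleR)
        qed
        then show ?thesis
          by (simp add: \<psi>_def)
      qed
      show "\<psi> J (\<Sum>i\<in>S. d i) = \<psi> J (\<Sum>i\<in>S \<inter> T J. d i)" if J: "J \<in> \<J>" and S: "S \<subseteq> V" for J S
      proof -
        have finS: "finite S"
          using S finite_V finite_subset by blast
        have "fJ J (y + (\<Sum>i\<in>S. d i)) = fJ J (y + (\<Sum>i\<in>S \<inter> T J. d i))"
        proof (rule fJ_blocks[OF J])
          fix k assume "k \<in> J"
          then have k: "k \<in> T J"
            using T[OF J] by auto
          have "block blk k (\<Sum>i\<in>S. d i) = (if k \<in> S then d k else 0)"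
            using S V_eq d finS by (intro block_sum_block_space) auto
          moreover have "block blk k (\<Sum>i\<in>S \<inter> T J. d i) = (if k \<in> S \<inter> T J then d k else 0)"
            using S V_eq d finS by (intro block_sum_block_space) auto
          ultimately show "block blk k (y + (\<Sum>i\<in>S. d i)) = block blk k (y + (\<Sum>i\<in>S \<inter> T J. d i))"
            using k by (simp add: block_add)
        qed
        then show ?thesis
          by (simp add: \<psi>_def)
      qed
      show "(\<Sum>J\<in>\<J>. \<psi> J (r *\<^sub>R d i)) \<le> r * (gradient f y \<bullet> d i) + r\<^sup>2 * b i" if "i \<in> V" for i r
        using smooth[of i r] that V_eq by (simp add: sum_\<psi>)
    qed
    then show ?thesis
      by (simp add: sum_\<psi> V_eq)
  qed
qed

text \<open>\<open>1 - \<gamma> \<le> exp (- \<gamma>)\<close> converts geometric decay into a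
  logarithmic iteration count; \<open>\<gamma> \<le> 1\<close> keeps the base nonnegative.\<close>

lemma power_le_of_log_bound:
  fixes \<gamma> \<Phi>0 \<delta> :: real
  assumes "\<gamma> \<le> 1" "0 < \<Phi>0" "0 < \<delta>" "ln (\<Phi>0 / \<delta>) \<le> \<gamma> * real K"
  shows "(1 - \<gamma>) ^ K * \<Phi>0 \<le> \<delta>"
proof -
  have "(1 - \<gamma>) ^ K \<le> exp (- \<gamma>) ^ K"
    using assms exp_ge_add_one_self[of "- \<gamma>"] by (intro power_mono) auto
  also have "\<dots> = exp (- (\<gamma> * real K))"
    by (simp add: exp_of_nat_mult[symmetric] mult.commute)
  also have "\<dots> \<le> exp (- ln (\<Phi>0 / \<delta>))"
    using assms by simp
  also have "\<dots> = \<delta> / \<Phi>0"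
    using assms by (simp add: exp_minus)
  finally show ?thesis
    using assms by (simp add: field_simps)
qed

theorem theorem6:
  fixes n :: nat
    and blk :: "'m::finite \<Rightarrow> nat"
    and nrm :: "nat \<Rightarrow> real ^ 'm \<Rightarrow> real"
    and \<J> :: "nat set set"
    and fJ :: "nat set \<Rightarrow> real ^ 'm \<Rightarrow> real"
    and f :: "real ^ 'm \<Rightarrow> real"
    and L w :: "nat \<Rightarrow> real"
    and \<Omega> :: "nat \<Rightarrow> real ^ 'm \<Rightarrow> ereal"
    and F :: "real ^ 'm \<Rightarrow> ereal"
    and Fstar :: real
    and C s \<tau> \<xi> K :: nat
    and P :: "nat \<Rightarrow> nat set"
    and \<beta> \<mu>f \<mu>\<Omega> \<epsilon> \<rho> :: real
    and x0 :: "real ^ 'm"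
    and h :: "nat \<Rightarrow> real ^ 'm \<Rightarrow> real ^ 'm"
    and M :: "'w measure"
    and Z :: "nat \<Rightarrow> 'w \<Rightarrow> nat set"
    and x :: "nat \<Rightarrow> 'w \<Rightarrow> real ^ 'm"
  assumes blocks: "\<And>j. blk j \<in> {1..n}"
    and norms: "\<And>i. i \<in> {1..n} \<Longrightarrow> is_norm_on (block_space blk i) (nrm i)"
    and J_subsets: "\<J> \<subseteq> Pow {1..n}" "\<J> \<noteq> {}"
    and f_sum: "\<And>y. f y = (\<Sum>J\<in>\<J>. fJ J y)"
    and fJ_convex: "\<And>J. J \<in> \<J> \<Longrightarrow> convex_on UNIV (fJ J)"
    and fJ_blocks: "\<And>J y z. J \<in> \<J> \<Longrightarrow> (\<And>i. i \<in> J \<Longrightarrow> block blk i y = block blk i z) \<Longrightarrow> fJ J y = fJ J z"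
    and f_diff: "\<And>y. f differentiable (at y)"
    and L_pos: "\<And>i. i \<in> {1..n} \<Longrightarrow> 0 < L i"
    and f_lipschitz: "\<And>i y t. i \<in> {1..n} \<Longrightarrow> t \<in> block_space blk i \<Longrightarrow>
          conj_norm (block_space blk i) (nrm i)
            (block blk i (gradient f (y + t)) - block blk i (gradient f y)) \<le> L i * nrm i t"
    and Omega_no_minf: "\<And>i t. i \<in> {1..n} \<Longrightarrow> t \<in> block_space blk i \<Longrightarrow> \<Omega> i t \<noteq> - \<infinity>"
    and Omega_convex: "\<And>i. i \<in> {1..n} \<Longrightarrow> convex (ereal_epigraph (block_space blk i) (\<Omega> i))"
    and Omega_closed: "\<And>i. i \<in> {1..n} \<Longrightarrow> closed (ereal_epigraph (block_space blk i) (\<Omega> i))"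
    and F_def: "\<And>y. F y = ereal (f y) + block_separable blk n \<Omega> y"
    and F_opt: "(INF y. F y) = ereal Fstar" "\<exists>y. F y = ereal Fstar"
    and C_pos: "1 \<le> C"
    and s_def: "real s = real n / real C"
    and partition: "balanced_partition n C s P"
    and tau: "\<tau> \<in> {1..s}"
    and xi_def: "\<xi> = Max {card (P c \<inter> J) | c J. c \<in> {1..C} \<and> J \<in> \<J>}"
    and beta_def: "\<beta> = 1 + (real \<xi> - 1) * (real \<tau> - 1) / max 1 (real s - 1)
                        + (real C - 1) * (real \<xi> * real \<tau> / real s)"
    and w_def: "\<And>i. i \<in> {1..n} \<Longrightarrow> w i = L i"
    and F_strong: "\<exists>\<mu>>0. strongly_convex_wrt (wnorm blk n nrm w) F \<mu>"
    and f_strong: "strongly_convex_wrt (wnorm blk n nrm w) (\<lambda>y. ereal (f y)) \<mu>f"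
    and Omega_strong: "strongly_convex_wrt (wnorm blk n nrm w) (block_separable blk n \<Omega>) \<mu>\<Omega>"
    and mu_pos: "\<mu>f + \<mu>\<Omega> > 0"
    and x0_dom: "F x0 < \<infinity>"
    and rho: "0 < \<rho>" "\<rho> < 1"
    and eps: "0 < \<epsilon>" "\<epsilon> < real_of_ereal (F x0) - Fstar"
    and K_bound: "real K \<ge> real n / (real C * real \<tau>) * ((\<beta> + \<mu>\<Omega>) / (\<mu>f + \<mu>\<Omega>))
                        * ln ((real_of_ereal (F x0) - Fstar) / (\<epsilon> * \<rho>))"
    and prob_M: "prob_space M"
    and Z_subset: "\<And>k \<omega>. \<omega> \<in> space M \<Longrightarrow> Z k \<omega> \<subseteq> {1..n}"
    and Z_indep: "prob_space.indep_vars M (\<lambda>_. count_space UNIV) Z UNIV"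
    and Z_law: "\<And>k. distr M (count_space UNIV) (Z k) = measure_pmf (distributed_sampling C \<tau> P)"
    and iterates: "dbcd_iterates (space M) blk n nrm f \<Omega> \<beta> w h Z x0 x"
  shows "measure M {\<omega> \<in> space M. F (x K \<omega>) - ereal Fstar \<le> ereal \<epsilon>} \<ge> 1 - \<rho>"
proof -
  interpret prob_space M
    by (fact prob_M)

  \<comment> \<open>Instantiating the sampling, the overapproximation and the curvature
    bound\<close>
  have n_eq: "n = C * s"
    using s_def C_pos by (simp add: field_simps flip: of_nat_mult)
  have C: "real C > 0" and s: "real s > 0" and tau': "real \<tau> > 0" "real \<tau> \<le> real s"
    using C_pos tau by auto
  \<comment> \<open>An infinite part would have cardinality 0, contrary to
    \<open>s > 0\<close>.\<close>
  have fin_P: "finite (P c)" if "c \<in> {1..C}" for c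
    using partition that s unfolding balanced_partition_def by (metis card.infinite of_nat_0 less_irrefl)
  interpret S: partition_sampling C s \<tau> P
    using fin_P partition tau by unfold_locales (auto simp: balanced_partition_def)
  interpret O: block_separable_regularizer n blk nrm w \<Omega>
    using blocks norms L_pos w_def Omega_no_minf Omega_convex Omega_closed by unfold_locales auto
  have V_eq: "S.V = {1..n}"
    using partition by (simp add: S.V_def balanced_partition_def)
  have law: "distr M (count_space UNIV) (Z k) = measure_pmf (pmf_of_set S.samples)" for k
    using Z_law S.samples_nonempty_and_uniform by (simp add: distributed_sampling_def)
  have samples: "finite S.samples" "S.samples \<noteq> {}" "\<And>S. S \<in> S.samples \<Longrightarrow> S \<subseteq> {1..n}"
    using S.finite_samples S.samples_nonempty V_eq by (auto simp: S.samples_def)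
  let ?p = "real \<tau> / real s"
  have marginal: "(\<Sum>S\<in>S.samples. of_bool (i \<in> S)) = real (card S.samples) * ?p" if "i \<in> {1..n}" for i
    using S.sum_samples_marginal that V_eq by simp
  have finJ: "finite \<J>"
    using J_subsets(1) by (rule finite_subset) simp
  have conv: "convex_on UNIV f"
    using convex_on_sum_functions[OF finJ fJ_convex] f_sum by presburger
  let ?X = "{card (P c \<inter> J) | c J. c \<in> {1..C} \<and> J \<in> \<J>}"
  have X: "?X = (\<lambda>(c, J). card (P c \<inter> J)) ` ({1..C} \<times> \<J>)"
    by (auto simp: image_iff) blast+
  have finX: "finite ?X"
    unfolding X using finJ by simp
  have "?X \<noteq> {}"
    unfolding X using J_subsets C_pos by simp
  then have "\<xi> \<in> ?X"
    unfolding xi_def using finX by (rule Max_in[rotated])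
  then obtain c J where "c \<in> {1..C}" "\<xi> = card (P c \<inter> J)"
    by blast
  then have xi_le: "\<xi> \<le> s"
    using card_mono[OF S.fin_P, of c "P c \<inter> J"] S.card_P[of c] by simp
  have xi_ge: "card (P c \<inter> J) \<le> \<xi>" if "c \<in> {1..C}" "J \<in> \<J>" for c J
    unfolding xi_def using that finX by (intro Max_ge) auto
  have eso: "(\<Sum>S\<in>S.samples. f (y + (\<Sum>i\<in>S. d i)) - f y) \<le> real (card S.samples) * ?p *
      (\<Sum>i\<in>{1..n}. gradient f y \<bullet> d i + \<beta> / 2 * (w i * (nrm i (d i))\<^sup>2))"
    if d: "\<And>i. i \<in> {1..n} \<Longrightarrow> d i \<in> block_space blk i" for y d
  proof -
    have smooth: "f (y + r *\<^sub>R d i) \<le> f y + r * (gradient f y \<bullet> d i) + r\<^sup>2 * (w i / 2 * (nrm i (d i))\<^sup>2)"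
      if i: "i \<in> {1..n}" for i r
    proof -
      have "f (y + r *\<^sub>R d i) \<le> f y + gradient f y \<bullet> (r *\<^sub>R d i) + L i / 2 * (nrm i (r *\<^sub>R d i))\<^sup>2"
        using f_diff norms[OF i] f_lipschitz[OF i] subspace_scale[OF subspace_block_space d[OF i]]
        by (rule block_smooth)
      then show ?thesis
        using O.norm_scaleR[OF i d[OF i]] w_def[OF i] by (simp add: power_mult_distrib mult.left_commute)
    qed
    have nonneg: "0 \<le> w i / 2 * (nrm i (d i))\<^sup>2" if "i \<in> {1..n}" for i
      using O.w_pos[OF that] by simp
    have "(\<Sum>S\<in>S.samples. f (y + (\<Sum>i\<in>S. d i)) - f y) \<le> real (card S.samples) * ?p *
        (\<Sum>i\<in>{1..n}. gradient f y \<bullet> d i + \<beta> * (w i / 2 * (nrm i (d i))\<^sup>2))"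
      by (rule partially_separable_overapproximation[of C s \<tau> P n \<J> f fJ blk y d _ \<xi>];
          fact S.partition_sampling_axioms V_eq J_subsets f_sum fJ_convex fJ_blocks f_diff smooth nonneg d
            xi_ge xi_le beta_def)
    then show ?thesis
      by (simp only: times_divide_eq_left times_divide_eq_right mult.assoc)
  qed
  have mu_le: "\<mu>f \<le> \<beta>"
    using conv f_diff f_strong samples _ marginal eso
    by (rule O.strong_convexity_parameter_le) (use tau' in auto)

  \<comment> \<open>The objective gap along the iterates\<close>
  obtain xs where xs: "F xs = ereal Fstar"
    using F_opt(2) by blast
  have F_dom: "F y = ereal (f y + O.R y)" if "y \<in> O.feasible" for y
    using that by (simp add: F_def O.separable_real)
  have F_infinite: "F y = \<infinity>" if "y \<notin> O.feasible" for y
    using that by (simp add: F_def O.separable_infinite)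
  have xs_dom: "xs \<in> O.feasible"
    using xs F_infinite by force
  then have xs_value: "f xs + O.R xs = Fstar"
    using F_dom xs by simp
  have x0_in: "x0 \<in> O.feasible"
    using x0_dom F_infinite by force
  define \<Phi> where "\<Phi> y = f y + O.R y - Fstar" for y
  have F_gap: "F y - ereal Fstar = ereal (\<Phi> y)" if "y \<in> O.feasible" for y
    using F_dom[OF that] by (simp add: \<Phi>_def)
  have \<Phi>_nonneg: "0 \<le> \<Phi> y" if "y \<in> O.feasible" for y
  proof -
    have "ereal Fstar \<le> F y"
      using F_opt(1) by (metis INF_lower UNIV_I)
    then show ?thesis
      using F_dom[OF that] by (simp add: \<Phi>_def)
  qed
  have x_0: "x 0 \<omega> = x0" if "\<omega> \<in> space M" for \<omega>
    using iterates that by (simp add: dbcd_iterates_def)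
  have x_Suc: "x (Suc k) \<omega> = x k \<omega> + (\<Sum>i\<in>Z k \<omega>. h i (x k \<omega>))" if "\<omega> \<in> space M" for k \<omega>
    using iterates that by (simp add: dbcd_iterates_def)
  have update: "is_block_update blk nrm f \<Omega> \<beta> w i (x k \<omega>) (h i (x k \<omega>))"
    if "\<omega> \<in> space M" "i \<in> {1..n}" for k \<omega> i
    using iterates that by (simp add: dbcd_iterates_def)
  have update_space: "h i (x k \<omega>) \<in> block_space blk i" if "\<omega> \<in> space M" "i \<in> {1..n}" for k \<omega> i
    using update[OF that] by (simp add: is_block_update_def is_arg_min_def)
  let ?\<alpha> = "(\<mu>f + \<mu>\<Omega>) / (\<beta> + \<mu>\<Omega>)"
  let ?\<gamma> = "?p * ?\<alpha>"
  have p: "0 \<le> ?p" "0 < ?p" "?p \<le> 1"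
    using tau' s by auto
  have step_dom: "x k \<omega> + (\<Sum>i\<in>S. h i (x k \<omega>)) \<in> O.feasible"
    and step_le: "(\<Sum>S\<in>S.samples. f (x k \<omega> + (\<Sum>i\<in>S. h i (x k \<omega>))) + O.R (x k \<omega> + (\<Sum>i\<in>S. h i (x k \<omega>))) - (f xs + O.R xs))
      \<le> real (card S.samples) * (1 - ?\<gamma>) * (f (x k \<omega>) + O.R (x k \<omega>) - (f xs + O.R xs))"
    if \<omega>: "\<omega> \<in> space M" and dom: "x k \<omega> \<in> O.feasible" and S: "S \<subseteq> {1..n}" for k \<omega> S
  proof -
    note decrease = O.expected_decrease[of f \<mu>f \<mu>\<Omega> \<beta> S.samples ?p "x k \<omega>" xs "\<lambda>i. h i (x k \<omega>)"]
    have eso_k: "(\<Sum>S\<in>S.samples. f (x k \<omega> + (\<Sum>i\<in>S. h i (x k \<omega>))) - f (x k \<omega>)) \<le> real (card S.samples) * ?p *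
        (\<Sum>i\<in>{1..n}. gradient f (x k \<omega>) \<bullet> h i (x k \<omega>) + \<beta> / 2 * (w i * (nrm i (h i (x k \<omega>)))\<^sup>2))"
      using update_space[OF \<omega>] by (rule eso)
    show "x k \<omega> + (\<Sum>i\<in>S. h i (x k \<omega>)) \<in> O.feasible"
      by (rule decrease(1);
          fact conv f_diff f_strong Omega_strong mu_pos mu_le samples p(1) marginal dom xs_dom update[OF \<omega>]
            eso_k S)
    show "(\<Sum>S\<in>S.samples. f (x k \<omega> + (\<Sum>i\<in>S. h i (x k \<omega>))) + O.R (x k \<omega> + (\<Sum>i\<in>S. h i (x k \<omega>))) - (f xs + O.R xs))
      \<le> real (card S.samples) * (1 - ?\<gamma>) * (f (x k \<omega>) + O.R (x k \<omega>) - (f xs + O.R xs))"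
      by (rule decrease(2);
          fact conv f_diff f_strong Omega_strong mu_pos mu_le samples p(1) marginal dom xs_dom update[OF \<omega>]
            eso_k)
  qed
  have x_dom: "x k \<omega> \<in> O.feasible" if \<omega>: "\<omega> \<in> space M" for k \<omega>
  proof (induction k)
    case 0
    then show ?case using x0_in x_0[OF \<omega>] by simp
  next
    case (Suc k)
    then show ?case
      using step_dom[OF \<omega> _ Z_subset[OF \<omega>]] by (simp add: x_Suc[OF \<omega>])
  qed
  have step: "(\<Sum>S\<in>S.samples. \<Phi> (x k \<omega> + (\<Sum>i\<in>S. h i (x k \<omega>)))) \<le>
      real (card S.samples) * (1 - ?\<gamma>) * \<Phi> (x k \<omega>)" if \<omega>: "\<omega> \<in> space M" for k \<omega>
    using step_le[OF \<omega> x_dom[OF \<omega>] empty_subsetI] by (simp add: \<Phi>_def xs_value)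
  have \<alpha>: "0 < ?\<alpha>" "?\<alpha> \<le> 1"
    using mu_pos mu_le by auto
  have \<gamma>: "?\<gamma> \<le> 1"
    using p \<alpha> by (intro mult_le_one) auto

  \<comment> \<open>From expected contraction to the probability bound\<close>
  have "integrable M (\<lambda>\<omega>. \<Phi> (x K \<omega>)) \<and> (\<integral>\<omega>. \<Phi> (x K \<omega>) \<partial>M) \<le> (1 - ?\<gamma>) ^ K * \<Phi> x0"
  proof (rule indep_iterates_contraction[where \<U> = "Pow {1..n}" and G = "\<lambda>y S. y + (\<Sum>i\<in>S. h i y)"])
    show "finite (Pow {1..n})" "S.samples \<subseteq> Pow {1..n}" "S.samples \<noteq> {}"
      using samples by auto
    show "0 \<le> 1 - ?\<gamma>"
      using \<gamma> by simp
  qed (use Z_subset Z_indep law x_0 x_Suc step in auto)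
  then have int: "integrable M (\<lambda>\<omega>. \<Phi> (x K \<omega>))" and E: "(\<integral>\<omega>. \<Phi> (x K \<omega>) \<partial>M) \<le> (1 - ?\<gamma>) ^ K * \<Phi> x0"
    by auto
  have \<Phi>x0: "real_of_ereal (F x0) - Fstar = \<Phi> x0"
    using F_dom[OF x0_in] by (simp add: \<Phi>_def)
  have "(1 - ?\<gamma>) ^ K * \<Phi> x0 \<le> \<epsilon> * \<rho>"
  proof (rule power_le_of_log_bound[OF \<gamma>])
    show "0 < \<Phi> x0" "0 < \<epsilon> * \<rho>"
      using eps rho \<Phi>x0 by auto
    \<comment> \<open>Since \<open>n = C * s\<close>, the factor in front of the logarithm is the
      reciprocal of the contraction rate.\<close>
    have "real n / (real C * real \<tau>) * ((\<beta> + \<mu>\<Omega>) / (\<mu>f + \<mu>\<Omega>)) = 1 / ?\<gamma>"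
      using C by (simp add: n_eq)
    then have "1 / ?\<gamma> * ln (\<Phi> x0 / (\<epsilon> * \<rho>)) \<le> real K"
      using K_bound unfolding \<Phi>x0 by simp
    moreover have "0 < ?\<gamma>"
      using p(2) \<alpha>(1) by (rule mult_pos_pos)
    moreover have "l \<le> g * r" if "1 / g * l \<le> r" "0 < g" for g l r :: real
      using that by (simp add: pos_divide_le_eq mult.commute)
    ultimately show "ln (\<Phi> x0 / (\<epsilon> * \<rho>)) \<le> ?\<gamma> * real K"
      by blast
  qed
  with E have E_le: "(\<integral>\<omega>. \<Phi> (x K \<omega>) \<partial>M) / \<epsilon> \<le> \<rho>"
    using eps by (simp add: pos_divide_le_eq mult.commute)
  have meas: "(\<lambda>\<omega>. \<Phi> (x K \<omega>)) \<in> borel_measurable M"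
    using int by auto
  \<comment> \<open>Markov's inequality at threshold \<open>\<epsilon>\<close>; the mean is at most
    \<open>\<epsilon> * \<rho>\<close>, which is why \<open>\<rho>\<close> stands inside the
    logarithm.\<close>
  have "prob {\<omega> \<in> space M. \<epsilon> \<le> \<Phi> (x K \<omega>)} \<le> (\<integral>\<omega>. \<Phi> (x K \<omega>) \<partial>M) / \<epsilon>"
    using int eps x_dom \<Phi>_nonneg
    by (intro integral_Markov_inequality_measure[where A = "{}"]) auto
  then have tail: "prob {\<omega> \<in> space M. \<epsilon> \<le> \<Phi> (x K \<omega>)} \<le> \<rho>"
    using E_le by linarith
  have "1 - \<rho> \<le> 1 - prob {\<omega> \<in> space M. \<epsilon> \<le> \<Phi> (x K \<omega>)}"
    using tail by simp
  also have "\<dots> = prob (space M - {\<omega> \<in> space M. \<epsilon> \<le> \<Phi> (x K \<omega>)})"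
    using meas by (subst prob_compl) auto
  \<comment> \<open>The complement is the strict event
    \<open>\<Phi> (x K \<omega>) < \<epsilon>\<close>, contained in the desired one.\<close>
  also have "\<dots> \<le> prob {\<omega> \<in> space M. \<Phi> (x K \<omega>) \<le> \<epsilon>}"
    using meas by (intro finite_measure_mono) auto
  also have "{\<omega> \<in> space M. \<Phi> (x K \<omega>) \<le> \<epsilon>} = {\<omega> \<in> space M. F (x K \<omega>) - ereal Fstar \<le> ereal \<epsilon>}"
    using F_gap x_dom by auto
  finally show ?thesis .
qed

end
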